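(* Consider the multicolored multiple-drawing randomly reinforced urn described in the context. Assume: (A1) there is a constant $C_2$ such that $\sup_n \mathbb{E}(A_{nk}^3)<C_2$ for all $k\in\{1,\dots,d\}$; (A2) for all $k\in\{1,\dots,d\}$, $m_{nk}:=\mathbb{E}(A_{nk})\to m_k$ as $n\to\infty$, where $m_1,\dots,m_d$ are finite reals with $m_1=\dots=m_t>m_{t+1}\ge m_{t+2}\ge\dots\ge m_d$ for some $t\in\{1,\dots,d\}$; moreover $m_{n1}=m_{n2}=\dots=m_{nt}$ for all $n\ge 1$; (N) $\mathbb E(N_{n+1}\mid\mathcal F_n)\to N$ almost surely, for some random variable $N$. Let $Z_k$ be the almost sure limit of $Z_{nk}$. Then, almost surely as $n\to\infty$, $$\frac{H_{nk}}{n}\to\begin{cases}Nm_1Z_k,&k\in\{1,\dots,t\},\\0,&k\in\{t+1,\dots,d\},\end{cases}\qquad\text{and}\qquad \frac{S_n}{n}\to Nm_1.$$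
   Context: Urn model. An urn contains balls of $d\ge 2$ colors. The initial composition is a deterministic vector $\mathbf H_0=(H_{01},\dots,H_{0d})^\top$ of positive integers. At each stage $n\ge1$, a random number $N_n$ of balls is drawn without replacement; $\mathbf X_n=(X_{n1},\dots,X_{nd})^\top$ records how many balls of each color are drawn, so $\sum_k X_{nk}=N_n$. The drawn balls are then returned together with $A_{nk}X_{nk}$ new balls of color $k$, for each $k$. Here $\mathbf R_n=\mathrm{diag}(A_{n1},\dots,A_{nd})$ is the random replacement matrix. So $H_{nk}=H_{0k}+\sum_{i=1}^n A_{ik}X_{ik}$, $S_n=\sum_{k=1}^d H_{nk}$ and $Z_{nk}=H_{nk}/S_n$. Let $\mathcal F_0$ be trivial, $\mathcal F_n=\sigma\{N_1,\mathbf X_1,\mathbf R_1,\dots,N_n,\mathbf X_n,\mathbf R_n\}$ and $\mathcal G_n=\sigma(\mathcal F_n,N_{n+1})$. Standing assumptions, for all $n\ge0$: (I) $N_{n+1}$ takes values in $\{1,2,\dots,\min(S_n,C_1)\}$ for some constant positive integer $C_1$. (II) Conditionally on $\mathcal G_n$, $\mathbf X_{n+1}$ is multivariate hypergeometric with parameters $(S_n,N_{n+1},\mathbf H_n)$: $\mathbb P(\mathbf X_{n+1}=\mathbf x\mid\mathcal G_n)=\prod_{k=1}^d\binom{H_{nk}}{x_k}\big/\binom{S_n}{N_{n+1}}$ for integer vectors $\mathbf x$ with $0\le x_k\le H_{nk}$ and $\sum_k x_k=N_{n+1}$. (III) Each $A_{n+1,k}$ takes (integer) values in $[1,\infty)$,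 and $\mathbf R_{n+1}$ is independent of $\sigma(\mathcal G_n,\mathbf X_{n+1})$. The components of $\mathbf R_{n+1}$ may be correlated with each other. Under (A1)–(A2) the almost sure limits $Z_k=\lim_nZ_{nk}$ exist for all $k$. *)

theory Defs
  imports "HOL-Probability.Probability"
begin

text \<open>
  Colors are the numbers \<open>1, \<dots>, d\<close> and stages the numbers \<open>n \<ge> 1\<close>: \<open>N n\<close> is the number of
  balls drawn at stage \<open>n\<close>, \<open>X n k\<close> the number of those of color \<open>k\<close>, and \<open>A n k\<close> the \<open>k\<close>-th
  diagonal entry of the replacement matrix of stage \<open>n\<close>. Values at stage \<open>0\<close> or at colors outside
  \<open>{1..d}\<close> are never used.
\<close>

definition urn_H ::
    "(nat \<Rightarrow> nat) \<Rightarrow> (nat \<Rightarrow> nat \<Rightarrow> 'a \<Rightarrow> nat) \<Rightarrow> (nat \<Rightarrow> nat \<Rightarrow> 'a \<Rightarrow> nat) \<Rightarrow> nat \<Rightarrow> nat \<Rightarrow> 'a \<Rightarrow> nat"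
  where "urn_H H0 X A n k \<omega> = H0 k + (\<Sum>i=1..n. A i k \<omega> * X i k \<omega>)"

definition urn_S ::
    "nat \<Rightarrow> (nat \<Rightarrow> nat) \<Rightarrow> (nat \<Rightarrow> nat \<Rightarrow> 'a \<Rightarrow> nat) \<Rightarrow> (nat \<Rightarrow> nat \<Rightarrow> 'a \<Rightarrow> nat) \<Rightarrow> nat \<Rightarrow> 'a \<Rightarrow> nat"
  where "urn_S d H0 X A n \<omega> = (\<Sum>k=1..d. urn_H H0 X A n k \<omega>)"

definition urn_Z ::
    "nat \<Rightarrow> (nat \<Rightarrow> nat) \<Rightarrow> (nat \<Rightarrow> nat \<Rightarrow> 'a \<Rightarrow> nat) \<Rightarrow> (nat \<Rightarrow> nat \<Rightarrow> 'a \<Rightarrow> nat) \<Rightarrow> nat \<Rightarrow> nat \<Rightarrow> 'a \<Rightarrow> real"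
  where "urn_Z d H0 X A n k \<omega> = real (urn_H H0 X A n k \<omega>) / real (urn_S d H0 X A n \<omega>)"

definition sigma_of :: "'a measure \<Rightarrow> ('a \<Rightarrow> nat) set \<Rightarrow> 'a measure"
  where "sigma_of M Ys = sigma (space M) {Y -` B \<inter> space M | Y B. Y \<in> Ys}"

definition urn_history ::
    "nat \<Rightarrow> (nat \<Rightarrow> 'a \<Rightarrow> nat) \<Rightarrow> (nat \<Rightarrow> nat \<Rightarrow> 'a \<Rightarrow> nat) \<Rightarrow> (nat \<Rightarrow> nat \<Rightarrow> 'a \<Rightarrow> nat) \<Rightarrow> nat
      \<Rightarrow> ('a \<Rightarrow> nat) set"
  where "urn_history d N X A n =
    {N i | i. i \<in> {1..n}} \<union> {X i k | i k. i \<in> {1..n} \<and> k \<in> {1..d}}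
      \<union> {A i k | i k. i \<in> {1..n} \<and> k \<in> {1..d}}"

definition urn_F ::
    "'a measure \<Rightarrow> nat \<Rightarrow> (nat \<Rightarrow> 'a \<Rightarrow> nat) \<Rightarrow> (nat \<Rightarrow> nat \<Rightarrow> 'a \<Rightarrow> nat) \<Rightarrow> (nat \<Rightarrow> nat \<Rightarrow> 'a \<Rightarrow> nat)
      \<Rightarrow> nat \<Rightarrow> 'a measure"
  where "urn_F M d N X A n = sigma_of M (urn_history d N X A n)"

definition urn_G ::
    "'a measure \<Rightarrow> nat \<Rightarrow> (nat \<Rightarrow> 'a \<Rightarrow> nat) \<Rightarrow> (nat \<Rightarrow> nat \<Rightarrow> 'a \<Rightarrow> nat) \<Rightarrow> (nat \<Rightarrow> nat \<Rightarrow> 'a \<Rightarrow> nat)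
      \<Rightarrow> nat \<Rightarrow> 'a measure"
  where "urn_G M d N X A n = sigma_of M (urn_history d N X A n \<union> {N (Suc n)})"

definition mv_hypergeometric :: "nat \<Rightarrow> nat \<Rightarrow> nat \<Rightarrow> (nat \<Rightarrow> nat) \<Rightarrow> (nat \<Rightarrow> nat) \<Rightarrow> real"
  where "mv_hypergeometric d s r h x =
    (if (\<forall>k\<in>{1..d}. x k \<le> h k) \<and> (\<Sum>k=1..d. x k) = r
     then (\<Prod>k=1..d. real (h k choose x k)) / real (s choose r)
     else 0)"

locale randomly_reinforced_urn = prob_space M
  for M :: "'a measure" +
  fixes d :: nat
    and C1 :: nat
    and H0 :: "nat \<Rightarrow> nat"
    and N :: "nat \<Rightarrow> 'a \<Rightarrow> nat"
    and X :: "nat \<Rightarrow> nat \<Rightarrow> 'a \<Rightarrow> nat"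
    and A :: "nat \<Rightarrow> nat \<Rightarrow> 'a \<Rightarrow> nat"
  assumes d_ge_2: "d \<ge> 2"
    and C1_pos: "C1 \<ge> 1"
    and H0_pos: "\<And>k. k \<in> {1..d} \<Longrightarrow> H0 k > 0"
    and N_measurable: "\<And>n. n \<ge> 1 \<Longrightarrow> N n \<in> measurable M (count_space UNIV)"
    and X_measurable:
      "\<And>n k. n \<ge> 1 \<Longrightarrow> k \<in> {1..d} \<Longrightarrow> X n k \<in> measurable M (count_space UNIV)"
    and A_measurable:
      "\<And>n k. n \<ge> 1 \<Longrightarrow> k \<in> {1..d} \<Longrightarrow> A n k \<in> measurable M (count_space UNIV)"
    and X_sum: "\<And>n \<omega>. n \<ge> 1 \<Longrightarrow> \<omega> \<in> space M \<Longrightarrow> (\<Sum>k=1..d. X n k \<omega>) = N n \<omega>"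
    and N_range: "\<And>n \<omega>. \<omega> \<in> space M \<Longrightarrow> N (Suc n) \<omega> \<in> {1..min (urn_S d H0 X A n \<omega>) C1}"
    and X_hypergeometric:
      "\<And>n x. AE \<omega> in M.
         real_cond_exp M (urn_G M d N X A n)
             (indicator {\<omega> \<in> space M. \<forall>k\<in>{1..d}. X (Suc n) k \<omega> = x k}) \<omega>
         = mv_hypergeometric d (urn_S d H0 X A n \<omega>) (N (Suc n) \<omega>) (\<lambda>k. urn_H H0 X A n k \<omega>) x"
    and A_ge_1: "\<And>n k \<omega>. k \<in> {1..d} \<Longrightarrow> \<omega> \<in> space M \<Longrightarrow> A (Suc n) k \<omega> \<ge> 1"
    and A_indep:
      "\<And>n. indep_set
         (sets (sigma_of M {A (Suc n) k | k. k \<in> {1..d}}))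
         (sets (sigma_of M
           (urn_history d N X A n \<union> {N (Suc n)} \<union> {X (Suc n) k | k. k \<in> {1..d}})))"

end

theory Submission
  imports Defs "HOL-Library.Discrete_Functions"
begin

text \<open>
  Write \<open>H\<^sub>k\<close>, \<open>S\<close> and \<open>Z\<^sub>k = H\<^sub>k / S\<close> for the number of balls of color \<open>k\<close>, the total number of balls and
  the share of color \<open>k\<close>, all at stage \<open>n\<close>; call the colors in \<open>{1..t}\<close> dominant and the
  other ones minor. Let \<open>B\<close> bound the second moments of the \<open>A n k\<close>.

  For a dominant color \<open>k\<close> consider the potential \<open>\<psi> = ln S - ln H\<^sub>k + K / H\<^sub>k\<close> with
  \<open>K = 2 C1\<^sup>2 B\<close>. The mean of a hypergeometric distribution and the independence of the
  replacement matrix give the conditional means \<open>m\<^sub>j N Z\<^sub>j\<close> of the increments of the \<open>H\<^sub>j\<close>,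
  where \<open>N\<close> is the number of balls drawn at the next stage and \<open>m\<^sub>j\<close> the mean of the next
  replacement of color \<open>j\<close>. Hence \<open>ln S\<close> grows on average by at most \<open>(N / S) \<Sum>\<^sub>j m\<^sub>j Z\<^sub>j\<close>, and
  \<open>ln H\<^sub>k\<close> by at least \<open>(N / S) m\<^sub>k\<close> minus a second-order error of at most \<open>C1 B N Z\<^sub>k / H\<^sub>k\<^sup>2\<close>.
  This error need not be small, as nothing is known yet about the growth of \<open>H\<^sub>k\<close>, but the
  summand \<open>K / H\<^sub>k\<close> decreases on average by at least as much, because it changes exactly when
  color \<open>k\<close> is drawn. So the drift of \<open>\<psi>\<close> is at most \<open>- (N / S) \<Sum>\<^sub>j (m\<^sub>k - m\<^sub>j) Z\<^sub>j\<close>, to which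
  only the minor colors contribute, and for large \<open>n\<close> it is at most \<open>- \<delta> / S\<close> times the joint
  share of the minor colors (\<open>potential_drift\<close>).

  Two conclusions follow. The process \<open>\<psi>\<close> is eventually a nonnegative supermartingale, so
  \<open>exp (- \<psi>)\<close> is a bounded submartingale and converges almost surely
  (\<open>exp_minus_supermartingale_AE_convergent\<close>); since \<open>H\<^sub>k\<close> is nondecreasing, \<open>K / H\<^sub>k\<close> converges
  too, and therefore so does \<open>Z\<^sub>k\<close>. Summing the drift shows moreover that
  the joint share of the minor colors divided by \<open>S\<close> is almost surely summable. As \<open>S\<close> grows at most linearly and
  the harmonic series diverges, the joint minor share, which converges, must tend to \<open>0\<close>.

  The increments of \<open>S\<close> have bounded second moments, so a strong law of large numbers
  (\<open>average_minus_cond_exp_AE_tendsto_0\<close>) replaces them, in the average, by their conditional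
  expectations \<open>E(N | F) \<Sum>\<^sub>j m\<^sub>j Z\<^sub>j\<close>. It yields the linear growth used above, and,
  once the shares of the minor colors are known to vanish, the limit of \<open>S / n\<close>; finally
  \<open>H\<^sub>k / n = Z\<^sub>k (S / n)\<close>.
\<close>

section \<open>Averages and series of real numbers\<close>

lemma cesaro_tendsto:
  fixes c :: "nat \<Rightarrow> real"
  assumes "c \<longlonglongrightarrow> L"
  shows "(\<lambda>n. (\<Sum>i<n. c i) / real n) \<longlonglongrightarrow> L"
proof (rule LIMSEQ_I)
  fix r :: real assume r: "r > 0"
  obtain n0 where n0: "\<And>i. i \<ge> n0 \<Longrightarrow> \<bar>c i - L\<bar> < r / 2"
    using LIMSEQ_D[OF assms, of "r / 2"] r by auto
  define K where "K = (\<Sum>i<n0. \<bar>c i - L\<bar>)"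
  have K: "K \<ge> 0" unfolding K_def by (simp add: sum_nonneg)
  obtain n1 :: nat where n1: "2 * K / r < real n1" using reals_Archimedean2 by blast
  show "\<exists>no. \<forall>n\<ge>no. norm ((\<Sum>i<n. c i) / real n - L) < r"
  proof (intro exI allI impI)
    fix n assume n: "n \<ge> max (max n0 n1) 1"
    have "\<bar>(\<Sum>i<n. c i) - n * L\<bar> = \<bar>\<Sum>i<n. (c i - L)\<bar>" by (simp add: sum_subtractf)
    also have "\<dots> \<le> (\<Sum>i<n. \<bar>c i - L\<bar>)" by (rule sum_abs)
    also have "\<dots> = K + (\<Sum>i\<in>{n0..<n}. \<bar>c i - L\<bar>)"
      unfolding K_def using n by (metis (no_types, lifting) atLeast0LessThan le0 max.boundedE sum.atLeastLessThan_concat)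
    also have "(\<Sum>i\<in>{n0..<n}. \<bar>c i - L\<bar>) \<le> (\<Sum>i\<in>{n0..<n}. r / 2)"
      by (rule sum_mono) (use n0 in \<open>force intro: less_imp_le\<close>)
    also have "\<dots> \<le> n * (r / 2)" using r by simp
    also have "K + n * (r / 2) < n * r"
    proof -
      have "2 * K < r * real n1" using n1 r by (simp add: field_simps)
      also have "\<dots> \<le> r * n" using n r by simp
      finally show ?thesis by (simp add: field_simps)
    qed
    finally have "\<bar>(\<Sum>i<n. c i) - n * L\<bar> < n * r" by simp
    moreover have "(\<Sum>i<n. c i) / real n - L = ((\<Sum>i<n. c i) - n * L) / n"
      using n by (simp add: field_simps)
    ultimately show "norm ((\<Sum>i<n. c i) / real n - L) < r"
      using n by (simp add: field_simps)
  qed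
qed

text \<open>
  For increments \<open>a i - c i\<close> that are bounded below, convergence of the averages along the squares
  suffices: between \<open>j\<^sup>2\<close> and \<open>(j + 1)\<^sup>2\<close> the partial sums lose at most \<open>C (2 j + 1)\<close>, so that they are
  controlled by their values at the two ends.
\<close>
lemma tendsto_average_from_squares:
  fixes a c :: "nat \<Rightarrow> real"
  assumes a: "\<And>i. a i \<ge> 0" and c: "\<And>i. 0 \<le> c i" "\<And>i. c i \<le> C"
    and sq: "(\<lambda>j. (\<Sum>i<j\<^sup>2. a i - c i) / real (j\<^sup>2)) \<longlonglongrightarrow> 0"
  shows "(\<lambda>n. (\<Sum>i<n. a i - c i) / real n) \<longlonglongrightarrow> 0"
proof -
  define s where "s n = (\<Sum>i<n. a i - c i)" for n
  define u where "u j = s (j\<^sup>2) / real (j\<^sup>2)" for j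
  define q where "q j = \<bar>u j\<bar> + \<bar>u (Suc j)\<bar> * (1 + 1 / real j)\<^sup>2 + C * (2 / real j + (1 / real j)\<^sup>2)" for j
  have C: "C \<ge> 0" using c[of 0] by linarith
  have u: "u \<longlonglongrightarrow> 0" using sq unfolding u_def s_def .
  have inv: "(\<lambda>j. 1 / real j) \<longlonglongrightarrow> 0" by (rule lim_1_over_n)
  have "q \<longlonglongrightarrow> \<bar>0\<bar> + \<bar>0\<bar> * (1 + 0)\<^sup>2 + C * (2 * 0 + 0\<^sup>2)"
    unfolding q_def
    by (intro tendsto_intros tendsto_rabs u LIMSEQ_Suc[OF u] inv tendsto_mult[of "\<lambda>_. C"])
      (use tendsto_mult[OF tendsto_const[of "2::real"] inv] in simp)
  then have q: "q \<longlonglongrightarrow> 0" by simp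
  have sqrt_top: "filterlim floor_sqrt sequentially sequentially"
    unfolding filterlim_at_top
  proof
    fix Z :: nat
    have "Z \<le> floor_sqrt n" if "n \<ge> Z\<^sup>2" for n
      using that le_floor_sqrt_iff by blast
    then show "\<forall>\<^sub>F n in sequentially. Z \<le> floor_sqrt n"
      using eventually_sequentially by blast
  qed
  have lower: "s n \<ge> s m - C * (real n - real m)" if "m \<le> n" for m n
  proof -
    have "s n = s m + (\<Sum>i\<in>{m..<n}. a i - c i)" unfolding s_def
      by (metis atLeast0LessThan le0 sum.atLeastLessThan_concat that)
    moreover have "(\<Sum>i\<in>{m..<n}. a i - c i) \<ge> (\<Sum>i\<in>{m..<n}. - C)"
      by (rule sum_mono) (use a c in \<open>smt (verit)\<close>)
    ultimately show ?thesis using that by (simp add: of_nat_diff algebra_simps)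
  qed
  have bound: "\<bar>s n / real n\<bar> \<le> q (floor_sqrt n)" if "n \<ge> 1" for n
  proof -
    define j where "j = floor_sqrt n"
    have j1: "j \<ge> 1" using that le_floor_sqrt_iff[of 1 n] unfolding j_def by simp
    have jn: "j\<^sup>2 \<le> n" unfolding j_def by simp
    have nj: "n \<le> (Suc j)\<^sup>2" unfolding j_def using Suc_floor_sqrt_power2_gt less_imp_le by blast
    have w: "real ((Suc j)\<^sup>2) = real (j\<^sup>2) + 2 * j + 1" by (simp add: power2_eq_square algebra_simps)
    have n_bounds: "real (j\<^sup>2) \<le> n" "n \<le> real (j\<^sup>2) + 2 * j + 1"
      using jn nj w by (metis of_nat_le_iff)+
    have "s n \<ge> s (j\<^sup>2) - C * (2 * j + 1)"
    proof -
      have "C * (real n - real (j\<^sup>2)) \<le> C * (2 * j + 1)"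
        using n_bounds C by (intro mult_left_mono) auto
      then show ?thesis using lower[OF jn] by linarith
    qed
    moreover have "s n \<le> s ((Suc j)\<^sup>2) + C * (2 * j + 1)"
    proof -
      have "C * (real ((Suc j)\<^sup>2) - real n) \<le> C * (2 * j + 1)"
        using n_bounds w C by (intro mult_left_mono) linarith+
      then show ?thesis using lower[OF nj] by linarith
    qed
    ultimately have "\<bar>s n\<bar> \<le> \<bar>s (j\<^sup>2)\<bar> + \<bar>s ((Suc j)\<^sup>2)\<bar> + C * (2 * j + 1)" by linarith
    also have "\<dots> = q j * real (j\<^sup>2)"
    proof -
      have e1: "\<bar>u j\<bar> * real (j\<^sup>2) = \<bar>s (j\<^sup>2)\<bar>" using j1 unfolding u_def by (simp add: abs_mult)
      have e2: "\<bar>u (Suc j)\<bar> * (1 + 1 / real j)\<^sup>2 * real (j\<^sup>2) = \<bar>s ((Suc j)\<^sup>2)\<bar>"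
      proof -
        have "(1 + 1 / real j)\<^sup>2 * real (j\<^sup>2) = real ((Suc j)\<^sup>2)"
          using j1 by (simp add: power2_eq_square field_simps)
        moreover have "\<bar>u (Suc j)\<bar> * real ((Suc j)\<^sup>2) = \<bar>s ((Suc j)\<^sup>2)\<bar>"
          unfolding u_def by (simp add: abs_mult)
        ultimately show ?thesis by (metis mult.assoc)
      qed
      have e3: "C * (2 / real j + (1 / real j)\<^sup>2) * real (j\<^sup>2) = C * (2 * j + 1)"
        using j1 by (simp add: power2_eq_square field_simps)
      show ?thesis unfolding q_def using e1 e2 e3 by (simp only: distrib_right)
    qed
    also have "\<dots> \<le> q j * n"
      unfolding q_def using n_bounds C by (intro mult_left_mono) auto
    finally show ?thesis using that unfolding j_def by (simp add: field_simps)
  qed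
  have "(\<lambda>n. s n / real n) \<longlonglongrightarrow> 0"
  proof (rule Lim_null_comparison)
    show "\<forall>\<^sub>F n in sequentially. norm (s n / real n) \<le> q (floor_sqrt n)"
      using bound by (auto simp: eventually_sequentially)
    show "(\<lambda>n. q (floor_sqrt n)) \<longlonglongrightarrow> 0" by (rule filterlim_compose[OF q sqrt_top])
  qed
  then show ?thesis unfolding s_def .
qed

lemma limit_zero_if_summable_quotient:
  fixes b s :: "nat \<Rightarrow> real"
  assumes lim: "b \<longlonglongrightarrow> l" and b: "\<And>n. b n \<ge> 0"
    and s: "\<And>n. s n > 0" "\<And>n. s (Suc n) \<le> L * real (Suc n)"
    and summ: "summable (\<lambda>n. b n / s n)"
  shows "l = 0"
proof (rule ccontr)
  assume "l \<noteq> 0"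
  then have l: "l > 0" using LIMSEQ_le_const[OF lim] b by force
  have L: "L > 0" using s(1)[of "Suc 0"] s(2)[of 0] by simp
  from order_tendstoD(1)[OF lim, of "l / 2"] l obtain n0
    where n0: "\<And>n. n \<ge> n0 \<Longrightarrow> b n > l / 2" unfolding eventually_sequentially by auto
  have "summable (\<lambda>n. (l / (2 * L)) * inverse (real (Suc n)))"
  proof (rule summable_comparison_test)
    show "summable (\<lambda>n. b (Suc n) / s (Suc n))" using summ by (subst summable_Suc_iff)
    have "(l / 2) / (L * real (Suc n)) \<le> b (Suc n) / s (Suc n)" if "n \<ge> n0" for n
      using n0[of "Suc n"] s[of "Suc n"] s(2)[of n] that l L
      by (intro frac_le) auto
    then show "\<exists>N. \<forall>n\<ge>N. norm ((l / (2 * L)) * inverse (real (Suc n))) \<le> b (Suc n) / s (Suc n)"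
      using l L by (intro exI[of _ n0]) (auto simp: field_simps)
  qed
  then have "summable (\<lambda>n. inverse (real (Suc n)))"
    using l L by (subst (asm) summable_cmult_iff) auto
  then have "summable (\<lambda>n. inverse (real n))" by (subst (asm) summable_Suc_iff)
  then show False using not_summable_harmonic[where 'a=real] by (simp add: inverse_eq_divide)
qed

section \<open>The mean of the multivariate hypergeometric distribution\<close>

lemma sum_PiE_insert:
  assumes "finite I" "i \<notin> I"
  shows "(\<Sum>x\<in>Pi\<^sub>E (insert i I) B. f x) = (\<Sum>y\<in>B i. \<Sum>x\<in>Pi\<^sub>E I B. f (x(i := y)))"
  unfolding PiE_insert_eq
  by (subst sum.reindex[OF inj_combinator[OF assms(2)]]) (simp add: sum.cartesian_product case_prod_beta)

text \<open>
  The box \<open>{..c}\<close> only serves to make the index set finite; by \<open>r \<le> c\<close> it contains all vectors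
  with sum \<open>r\<close>.
\<close>
lemma multi_vandermonde:
  fixes h :: "'i \<Rightarrow> nat"
  assumes "finite I" "r \<le> c"
  shows "(\<Sum>x\<in>Pi\<^sub>E I (\<lambda>_. {..c}). if (\<Sum>i\<in>I. x i) = r then \<Prod>i\<in>I. h i choose x i else 0)
    = (\<Sum>i\<in>I. h i) choose r"
  using assms
proof (induction I arbitrary: r rule: finite_induct)
  case empty
  then show ?case by (cases r) auto
next
  case (insert i I)
  have upd: "(\<Sum>j\<in>I. (x(i := y)) j) = (\<Sum>j\<in>I. x j)"
    "(\<Prod>j\<in>I. h j choose (x(i := y)) j) = (\<Prod>j\<in>I. h j choose x j)" for x :: "'i \<Rightarrow> nat" and y
    using insert.hyps by (auto intro!: sum.cong prod.cong)
  have "(\<Sum>x\<in>Pi\<^sub>E (insert i I) (\<lambda>_. {..c}).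
        if (\<Sum>j\<in>insert i I. x j) = r then \<Prod>j\<in>insert i I. h j choose x j else 0)
     = (\<Sum>y\<le>c. \<Sum>x\<in>Pi\<^sub>E I (\<lambda>_. {..c}).
        if y + (\<Sum>j\<in>I. x j) = r then (h i choose y) * (\<Prod>j\<in>I. h j choose x j) else 0)"
    unfolding sum_PiE_insert[OF insert.hyps]
    by (simp only: sum.insert[OF insert.hyps] prod.insert[OF insert.hyps] upd fun_upd_same)
  also have "\<dots> = (\<Sum>y\<le>c. if y \<le> r then (h i choose y) * ((\<Sum>j\<in>I. h j) choose (r - y)) else 0)"
  proof (rule sum.cong[OF refl], goal_cases)
    case (1 y)
    show ?case
    proof (cases "y \<le> r")
      case True
      then have eq: "y + k = r \<longleftrightarrow> k = r - y" for k by auto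
      have "r - y \<le> c" using insert.prems by simp
      from insert.IH[OF this, symmetric] show ?thesis
        unfolding eq using True by (auto simp: sum_distrib_left intro!: sum.cong)
    qed (auto intro!: sum.neutral)
  qed
  also have "\<dots> = (\<Sum>y\<le>r. (h i choose y) * ((\<Sum>j\<in>I. h j) choose (r - y)))"
    using insert.prems by (intro sum.mono_neutral_cong_right) auto
  also have "\<dots> = (\<Sum>j\<in>insert i I. h j) choose r"
    using insert.hyps by (simp add: vandermonde)
  finally show ?case .
qed

lemma multi_vandermonde_weighted:
  fixes h :: "'i \<Rightarrow> nat"
  assumes "finite I" "k \<in> I" "Suc r \<le> c"
  shows "(\<Sum>x\<in>Pi\<^sub>E I (\<lambda>_. {..c}). if (\<Sum>i\<in>I. x i) = Suc r then x k * (\<Prod>i\<in>I. h i choose x i) else 0)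
    = h k * (((\<Sum>i\<in>I. h i) - 1) choose r)"
proof -
  define J where "J = I - {k}"
  have J: "finite J" "k \<notin> J" "I = insert k J" using assms unfolding J_def by auto
  have upd: "(\<Sum>j\<in>J. (x(k := y)) j) = (\<Sum>j\<in>J. x j)"
    "(\<Prod>j\<in>J. h j choose (x(k := y)) j) = (\<Prod>j\<in>J. h j choose x j)" for x :: "'i \<Rightarrow> nat" and y
    using J by (auto intro!: sum.cong prod.cong)
  have "(\<Sum>x\<in>Pi\<^sub>E I (\<lambda>_. {..c}). if (\<Sum>i\<in>I. x i) = Suc r then x k * (\<Prod>i\<in>I. h i choose x i) else 0)
     = (\<Sum>y\<le>c. \<Sum>x\<in>Pi\<^sub>E J (\<lambda>_. {..c}).
        if y + (\<Sum>j\<in>J. x j) = Suc r then y * ((h k choose y) * (\<Prod>j\<in>J. h j choose x j)) else 0)"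
    unfolding J(3) sum_PiE_insert[OF J(1,2)]
    by (simp only: sum.insert[OF J(1,2)] prod.insert[OF J(1,2)] upd fun_upd_same)
  also have "\<dots> = (\<Sum>y\<le>c. if y \<le> Suc r then y * (h k choose y) * ((\<Sum>j\<in>J. h j) choose (Suc r - y)) else 0)"
  proof (rule sum.cong[OF refl], goal_cases)
    case (1 y)
    show ?case
    proof (cases "y \<le> Suc r")
      case True
      then have eq: "y + k = Suc r \<longleftrightarrow> k = Suc r - y" for k by auto
      have "Suc r - y \<le> c" using assms by simp
      from multi_vandermonde[OF J(1) this, of h, symmetric] show ?thesis
        unfolding eq using True by (auto simp: sum_distrib_left mult.assoc intro!: sum.cong)
    qed (auto intro!: sum.neutral)
  qed
  also have "\<dots> = (\<Sum>y\<le>Suc r. y * (h k choose y) * ((\<Sum>j\<in>J. h j) choose (Suc r - y)))"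
    using assms by (intro sum.mono_neutral_cong_right) auto
  also have "\<dots> = (\<Sum>y\<le>r. Suc y * (h k choose Suc y) * ((\<Sum>j\<in>J. h j) choose (r - y)))"
    by (subst sum.atMost_Suc_shift) simp
  also have "\<dots> = h k * (\<Sum>y\<le>r. ((h k - 1) choose y) * ((\<Sum>j\<in>J. h j) choose (r - y)))"
  proof -
    have "Suc y * (h k choose Suc y) = h k * ((h k - 1) choose y)" for y
      by (cases "h k") (simp_all only: Suc_times_binomial_eq diff_Suc_1, simp_all add: mult.commute)
    then show ?thesis by (simp add: sum_distrib_left mult.assoc)
  qed
  also have "\<dots> = h k * (((\<Sum>i\<in>I. h i) - 1) choose r)"
    unfolding vandermonde J(3) using J by (cases "h k") auto
  finally show ?thesis .
qed

lemma mv_hypergeometric_mean: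
  assumes k: "k \<in> {1..d}" and s: "s = (\<Sum>i=1..d. h i)" and r: "1 \<le> r" "r \<le> s" "r \<le> c"
  shows "(\<Sum>x\<in>Pi\<^sub>E {1..d} (\<lambda>_. {..c}). real (x k) * mv_hypergeometric d s r h x)
    = real r * (real (h k) / real s)"
proof -
  obtain r' where r': "r = Suc r'" using r(1) by (cases r) auto
  obtain s' where s': "s = Suc s'" using r by (cases s) auto
  have summand: "real (x k) * mv_hypergeometric d s r h x
      = real (if (\<Sum>i=1..d. x i) = Suc r' then x k * (\<Prod>i=1..d. h i choose x i) else 0) / real (s choose r)" for x
  proof (cases "\<forall>i\<in>{1..d}. x i \<le> h i")
    case True
    then show ?thesis by (simp add: mv_hypergeometric_def r' of_nat_prod)
  next
    case False
    then have "(\<Prod>i=1..d. h i choose x i) = 0" by (auto simp: not_le intro!: prod_zero bexI)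
    with False show ?thesis by (auto simp: mv_hypergeometric_def)
  qed
  have "(\<Sum>x\<in>Pi\<^sub>E {1..d} (\<lambda>_. {..c}). real (x k) * mv_hypergeometric d s r h x)
    = real (\<Sum>x\<in>Pi\<^sub>E {1..d} (\<lambda>_. {..c}).
        if (\<Sum>i=1..d. x i) = Suc r' then x k * (\<Prod>i=1..d. h i choose x i) else 0) / real (s choose r)"
    unfolding summand by (simp only: sum_divide_distrib of_nat_sum)
  also have "\<dots> = real (h k * (s' choose r')) / real (s choose r)"
  proof -
    have "(\<Sum>i=1..d. h i) - 1 = s'" using s s' by simp
    then show ?thesis
      using multi_vandermonde_weighted[of "{1..d}" k r' c h] k r(3) r' by (simp only: finite_atLeastAtMost)
  qed
  also have "\<dots> = real r * (real (h k) / real s)"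
  proof -
    have "real r * real (s choose r) = real s * real (s' choose r')"
      unfolding r' s' of_nat_mult[symmetric] Suc_times_binomial_eq by (simp add: mult.commute)
    moreover have "real (s choose r) > 0" "real s > 0" using r(2) s' by auto
    ultimately show ?thesis by (simp add: field_simps)
  qed
  finally show ?thesis .
qed

section \<open>Almost sure convergence of bounded submartingales\<close>

lemma (in prob_space) AE_summable_if_sum_expectation_bounded:
  fixes f :: "nat \<Rightarrow> 'a \<Rightarrow> real"
  assumes int: "\<And>n. integrable M (f n)" and nonneg: "\<And>n \<omega>. \<omega> \<in> space M \<Longrightarrow> f n \<omega> \<ge> 0"
    and bound: "\<And>n. (\<Sum>i<n. expectation (f i)) \<le> B"
  shows "AE \<omega> in M. summable (\<lambda>n. f n \<omega>)"
proof -
  have meas [measurable]: "f n \<in> borel_measurable M" for n using int by auto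
  have nn: "(\<integral>\<^sup>+\<omega>. ennreal (f n \<omega>) \<partial>M) = ennreal (expectation (f n))" for n
    by (rule nn_integral_eq_integral[OF int]) (use nonneg in auto)
  have pos: "expectation (f n) \<ge> 0" for n by (rule integral_nonneg_AE) (use nonneg in auto)
  have "(\<integral>\<^sup>+\<omega>. (\<Sum>n. ennreal (f n \<omega>)) \<partial>M) = (\<Sum>n. ennreal (expectation (f n)))"
    by (subst nn_integral_suminf) (simp_all add: nn)
  also have "\<dots> \<le> ennreal B"
    unfolding suminf_eq_SUP by (rule SUP_least) (simp add: pos sum_ennreal bound ennreal_leI)
  finally have "(\<integral>\<^sup>+\<omega>. (\<Sum>n. ennreal (f n \<omega>)) \<partial>M) \<noteq> \<infinity>" by (auto simp: top_unique)
  then have "AE \<omega> in M. (\<Sum>n. ennreal (f n \<omega>)) \<noteq> \<infinity>"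
    by (intro nn_integral_PInf_AE) auto
  then show ?thesis
  proof (rule AE_mp, intro AE_I2 impI)
    fix \<omega> assume w: "\<omega> \<in> space M" "(\<Sum>n. ennreal (f n \<omega>)) \<noteq> \<infinity>"
    show "summable (\<lambda>n. f n \<omega>)"
      by (rule summable_suminf_not_top) (use w nonneg in auto)
  qed
qed

text \<open>
  A filtration indexed by the natural numbers. Submartingale properties are expressed below by integration
  against measurable weights \<open>g\<close> with values in \<open>[0, 1]\<close> instead of conditional expectations.
\<close>
locale discrete_filtration = prob_space M for M :: "'a measure" +
  fixes F :: "nat \<Rightarrow> 'a measure"
  assumes subalg: "\<And>n. subalgebra M (F n)"
    and step: "\<And>n. sets (F n) \<subseteq> sets (F (Suc n))"
begin

lemma space_F: "space (F n) = space M"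
  using subalg unfolding subalgebra_def by auto

lemma sets_F_mono: "m \<le> n \<Longrightarrow> sets (F m) \<subseteq> sets (F n)"
  by (rule lift_Suc_mono_le[of "\<lambda>n. sets (F n)"]) (use step in auto)

lemma measurable_F_mono:
  assumes "f \<in> measurable (F m) K" "m \<le> n" shows "f \<in> measurable (F n) K"
  by (rule measurable_from_subalg[OF _ assms(1)])
    (use sets_F_mono[OF assms(2)] in \<open>simp add: subalgebra_def space_F\<close>)

lemma measurable_F_M: "f \<in> measurable (F n) K \<Longrightarrow> f \<in> measurable M K"
  by (rule measurable_from_subalg[OF subalg])

text \<open>
  A maximal inequality. The probability that \<open>U\<close> rises by \<open>\<epsilon>\<close> above \<open>U n\<close>, and the
  probability that it drops by \<open>\<epsilon>\<close> below, are each bounded by splitting at the first time when this happens; the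
  splitting is done by induction on the length of the time interval.
\<close>
lemma bounded_submartingale_maximal:
  fixes U :: "nat \<Rightarrow> 'a \<Rightarrow> real"
  assumes adapted: "\<And>n. U n \<in> borel_measurable (F n)"
    and bounded: "\<And>n \<omega>. \<omega> \<in> space M \<Longrightarrow> 0 \<le> U n \<omega> \<and> U n \<omega> \<le> 1"
    and sub: "\<And>n g. g \<in> borel_measurable (F n) \<Longrightarrow> (\<And>\<omega>. \<omega> \<in> space M \<Longrightarrow> 0 \<le> g \<omega> \<and> g \<omega> \<le> 1)
        \<Longrightarrow> expectation (\<lambda>\<omega>. g \<omega> * U n \<omega>) \<le> expectation (\<lambda>\<omega>. g \<omega> * U (Suc n) \<omega>)"
    and eps: "\<epsilon> > 0"
  shows "\<epsilon> * prob {\<omega>\<in>space M. \<exists>j\<in>{n..n+k}. \<bar>U j \<omega> - U n \<omega>\<bar> \<ge> \<epsilon>}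
    \<le> 2 * expectation (\<lambda>\<omega>. \<bar>U (n+k) \<omega> - U n \<omega>\<bar>)"
proof -
  have UM [measurable]: "U n \<in> borel_measurable M" for n using adapted by (rule measurable_F_M)
  have U_int [simp]: "integrable M (U n)" for n
    by (rule integrable_const_bound[where B = 1]) (use bounded in \<open>auto intro!: AE_I2\<close>)
  define V where "V j \<omega> = U (n + j) \<omega> - U n \<omega>" for j \<omega>
  have VM [measurable]: "V j \<in> borel_measurable M" for j unfolding V_def by measurable
  have V_int [simp]: "integrable M (V j)" for j unfolding V_def by simp
  have V_F: "V j \<in> borel_measurable (F (n + i))" if "j \<le> i" for i j
  proof -
    have [measurable]: "U (n + j) \<in> borel_measurable (F (n + i))" "U n \<in> borel_measurable (F (n + i))"
      using measurable_F_mono[OF adapted] that by auto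
    show ?thesis unfolding V_def by measurable
  qed
  have V_ind [simp]: "integrable M (\<lambda>\<omega>. indicator D \<omega> * V j \<omega>)" if "D \<in> events" for D j
    using integrable_mult_indicator[OF that V_int] by simp
  have V_step: "expectation (\<lambda>\<omega>. indicator D \<omega> * V j \<omega>) \<le> expectation (\<lambda>\<omega>. indicator D \<omega> * V (Suc j) \<omega>)"
    if D: "D \<in> sets (F (n + j))" for D j
  proof -
    have DM: "D \<in> events" using D subalg unfolding subalgebra_def by auto
    have int: "integrable M (\<lambda>\<omega>. indicator D \<omega> * U i \<omega>)" for i
      using integrable_mult_indicator[OF DM U_int] by simp
    have "expectation (\<lambda>\<omega>. indicator D \<omega> * U (n + j) \<omega>)
      \<le> expectation (\<lambda>\<omega>. indicator D \<omega> * U (Suc (n + j)) \<omega>)"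
      by (rule sub) (use D in \<open>auto simp: indicator_def\<close>)
    then show ?thesis unfolding V_def right_diff_distrib by (simp add: int)
  qed
  \<comment> \<open>The events that neither level has been reached up to time \<open>n + j\<close>.\<close>
  define D where "D j = {\<omega>\<in>space M. \<forall>i\<in>{..j}. V i \<omega> < \<epsilon>}" for j
  define D' where "D' j = {\<omega>\<in>space M. \<forall>i\<in>{..j}. V i \<omega> > - \<epsilon>}" for j
  have D_F: "D j \<in> sets (F (n + j))" "D' j \<in> sets (F (n + j))" for j
  proof -
    have [measurable]: "V i \<in> borel_measurable (F (n + j))" if "i \<in> {..j}" for i using V_F that by auto
    have "{\<omega>\<in>space (F (n + j)). \<forall>i\<in>{..j}. V i \<omega> < \<epsilon>} \<in> sets (F (n + j))"
      "{\<omega>\<in>space (F (n + j)). \<forall>i\<in>{..j}. V i \<omega> > - \<epsilon>} \<in> sets (F (n + j))" by measurable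
    then show "D j \<in> sets (F (n + j))" "D' j \<in> sets (F (n + j))" unfolding D_def D'_def space_F by auto
  qed
  have DM [measurable]: "D j \<in> events" "D' j \<in> events" for j
    using D_F subalg unfolding subalgebra_def by blast+
  have D_Suc: "D (Suc j) = D j \<inter> {\<omega>\<in>space M. V (Suc j) \<omega> < \<epsilon>}"
    "D' (Suc j) = D' j \<inter> {\<omega>\<in>space M. V (Suc j) \<omega> > - \<epsilon>}" for j
    unfolding D_def D'_def by (auto simp: le_Suc_eq)
  have D_sub: "D (Suc j) \<subseteq> D j" "D j \<subseteq> space M" "D' (Suc j) \<subseteq> D' j" "D' j \<subseteq> space M" for j
    using D_Suc sets.sets_into_space[OF DM(1)] sets.sets_into_space[OF DM(2)] by auto
  have E_ind: "expectation (\<lambda>\<omega>. indicator B \<omega> * \<epsilon>) = \<epsilon> * prob B" if "B \<in> events" for B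
    using that by (simp add: sets.Int_space_eq2 mult.commute)
  have int_ind: "integrable M (\<lambda>\<omega>. indicator B \<omega> * \<epsilon>)" if "B \<in> events" for B
    using that by (intro integrable_mult_left integrable_real_indicator) (auto simp: emeasure_eq_measure)
  have upper: "\<epsilon> * prob (space M - D j) \<le> expectation (\<lambda>\<omega>. indicator (space M - D j) \<omega> * V j \<omega>)" for j
  proof (induction j)
    case 0
    have "D 0 = space M" unfolding D_def V_def using eps by auto
    then show ?case by simp
  next
    case (Suc j)
    let ?new = "D j - D (Suc j)"
    have [measurable]: "?new \<in> events" by measurable
    have split: "indicator (space M - D (Suc j)) \<omega> = (indicator (space M - D j) \<omega> + indicator ?new \<omega> :: real)"
      if "\<omega> \<in> space M" for \<omega>
      using that D_sub(1)[of j] by (auto simp: indicator_def)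
    have "space M - D (Suc j) = (space M - D j) \<union> ?new"
      using D_sub(1,2) by blast
    then have "prob (space M - D (Suc j)) = prob (space M - D j) + prob ?new"
      using finite_measure_Union[of "space M - D j" ?new] by auto
    then have "\<epsilon> * prob (space M - D (Suc j)) = \<epsilon> * prob (space M - D j) + \<epsilon> * prob ?new"
      by (simp add: distrib_left)
    also have "\<epsilon> * prob (space M - D j) \<le> expectation (\<lambda>\<omega>. indicator (space M - D j) \<omega> * V (Suc j) \<omega>)"
      using Suc.IH V_step[of "space M - D j" j] D_F[of j] sets.compl_sets[of "D j" "F (n + j)"]
      by (simp add: space_F)
    also have "\<epsilon> * prob ?new \<le> expectation (\<lambda>\<omega>. indicator ?new \<omega> * V (Suc j) \<omega>)"
      unfolding E_ind[OF \<open>?new \<in> events\<close>, symmetric]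
    proof (intro integral_mono int_ind V_ind)
      show "indicator ?new \<omega> * \<epsilon> \<le> indicator ?new \<omega> * V (Suc j) \<omega>" if "\<omega> \<in> space M" for \<omega>
        using that by (auto simp: D_Suc indicator_def)
    qed auto
    also have "expectation (\<lambda>\<omega>. indicator (space M - D j) \<omega> * V (Suc j) \<omega>)
        + expectation (\<lambda>\<omega>. indicator ?new \<omega> * V (Suc j) \<omega>)
      = expectation (\<lambda>\<omega>. indicator (space M - D (Suc j)) \<omega> * V (Suc j) \<omega>)"
    proof (subst Bochner_Integration.integral_add[symmetric])
      show "expectation (\<lambda>\<omega>. indicator (space M - D j) \<omega> * V (Suc j) \<omega> + indicator ?new \<omega> * V (Suc j) \<omega>)
        = expectation (\<lambda>\<omega>. indicator (space M - D (Suc j)) \<omega> * V (Suc j) \<omega>)"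
        by (intro Bochner_Integration.integral_cong) (simp_all add: split distrib_right)
    qed (intro V_ind, measurable)+
    finally show ?case by simp
  qed
  have lower: "\<epsilon> * prob (space M - D' j) \<le> expectation (\<lambda>\<omega>. indicator (D' j) \<omega> * V j \<omega>)" for j
  proof (induction j)
    case 0
    have "D' 0 = space M" unfolding D'_def V_def using eps by auto
    then show ?case by (simp add: V_def)
  next
    case (Suc j)
    let ?new = "D' j - D' (Suc j)"
    have [measurable]: "?new \<in> events" by measurable
    have split: "indicator (D' j) \<omega> = (indicator (D' (Suc j)) \<omega> + indicator ?new \<omega> :: real)" for \<omega>
      using D_sub(3)[of j] by (auto simp: indicator_def)
    have "space M - D' (Suc j) = (space M - D' j) \<union> ?new"
      using D_sub(3,4) by blast
    then have "prob (space M - D' (Suc j)) = prob (space M - D' j) + prob ?new"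
      using finite_measure_Union[of "space M - D' j" ?new] by auto
    then have "\<epsilon> * prob (space M - D' (Suc j)) = \<epsilon> * prob (space M - D' j) + \<epsilon> * prob ?new"
      by (simp add: distrib_left)
    also have "\<epsilon> * prob (space M - D' j) \<le> expectation (\<lambda>\<omega>. indicator (D' j) \<omega> * V (Suc j) \<omega>)"
      using Suc.IH V_step[of "D' j" j] D_F[of j] by simp
    also have "\<dots> = expectation (\<lambda>\<omega>. indicator (D' (Suc j)) \<omega> * V (Suc j) \<omega>)
        + expectation (\<lambda>\<omega>. indicator ?new \<omega> * V (Suc j) \<omega>)"
      by (subst Bochner_Integration.integral_add[symmetric])
        (auto simp: split distrib_right intro!: Bochner_Integration.integral_cong)
    also have "expectation (\<lambda>\<omega>. indicator ?new \<omega> * V (Suc j) \<omega>)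
        \<le> expectation (\<lambda>\<omega>. - (indicator ?new \<omega> * \<epsilon>))"
    proof (intro integral_mono V_ind)
      show "integrable M (\<lambda>\<omega>. - (indicator ?new \<omega> * \<epsilon>))"
        by (intro Bochner_Integration.integrable_minus int_ind) auto
    qed (auto simp: D_Suc indicator_def)
    also have "\<dots> = - (\<epsilon> * prob ?new)"
      unfolding E_ind[OF \<open>?new \<in> events\<close>, symmetric] by simp
    finally show ?case by simp
  qed
  have abs: "expectation (\<lambda>\<omega>. indicator B \<omega> * V k \<omega>) \<le> expectation (\<lambda>\<omega>. \<bar>V k \<omega>\<bar>)" if "B \<in> events" for B
    using that by (intro integral_mono V_ind integrable_abs V_int) (auto simp: indicator_def)
  have "{\<omega>\<in>space M. \<exists>j\<in>{n..n+k}. \<bar>U j \<omega> - U n \<omega>\<bar> \<ge> \<epsilon>} \<subseteq> (space M - D k) \<union> (space M - D' k)"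
  proof
    fix \<omega> assume "\<omega> \<in> {\<omega>\<in>space M. \<exists>j\<in>{n..n+k}. \<bar>U j \<omega> - U n \<omega>\<bar> \<ge> \<epsilon>}"
    then obtain j where w: "\<omega> \<in> space M" "n \<le> j" "j \<le> n + k" "\<bar>U j \<omega> - U n \<omega>\<bar> \<ge> \<epsilon>" by auto
    define i where "i = j - n"
    have "i \<le> k" "\<bar>V i \<omega>\<bar> \<ge> \<epsilon>" using w unfolding i_def V_def by auto
    then show "\<omega> \<in> (space M - D k) \<union> (space M - D' k)"
      using w(1) unfolding D_def D'_def by (cases "V i \<omega> \<ge> \<epsilon>") (auto simp: not_less intro!: bexI[of _ i])
  qed
  then have "prob {\<omega>\<in>space M. \<exists>j\<in>{n..n+k}. \<bar>U j \<omega> - U n \<omega>\<bar> \<ge> \<epsilon>}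
      \<le> prob ((space M - D k) \<union> (space M - D' k))"
    by (intro finite_measure_mono) auto
  also have "\<dots> \<le> prob (space M - D k) + prob (space M - D' k)"
    by (intro measure_Un_le) auto
  finally have "\<epsilon> * prob {\<omega>\<in>space M. \<exists>j\<in>{n..n+k}. \<bar>U j \<omega> - U n \<omega>\<bar> \<ge> \<epsilon>}
      \<le> \<epsilon> * prob (space M - D k) + \<epsilon> * prob (space M - D' k)"
    using eps by (simp flip: distrib_left)
  also have "\<dots> \<le> 2 * expectation (\<lambda>\<omega>. \<bar>V k \<omega>\<bar>)"
    using upper[of k] lower[of k] abs[of "space M - D k"] abs[of "D' k"] by simp
  finally show ?thesis unfolding V_def .
qed

text \<open>
  The second moments of \<open>U\<close> increase to a limit, and the submartingale property bounds
  the squared \<open>L\<^sup>2\<close>-distance of \<open>U m\<close> and \<open>U n\<close> by the difference of the second moments. With the maximal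
  inequality, the oscillation of \<open>U\<close> after time \<open>n\<close> tends to \<open>0\<close> in probability.
\<close>
theorem bounded_submartingale_AE_convergent:
  fixes U :: "nat \<Rightarrow> 'a \<Rightarrow> real"
  assumes adapted: "\<And>n. U n \<in> borel_measurable (F n)"
    and bounded: "\<And>n \<omega>. \<omega> \<in> space M \<Longrightarrow> 0 \<le> U n \<omega> \<and> U n \<omega> \<le> 1"
    and sub: "\<And>n g. g \<in> borel_measurable (F n) \<Longrightarrow> (\<And>\<omega>. \<omega> \<in> space M \<Longrightarrow> 0 \<le> g \<omega> \<and> g \<omega> \<le> 1)
        \<Longrightarrow> expectation (\<lambda>\<omega>. g \<omega> * U n \<omega>) \<le> expectation (\<lambda>\<omega>. g \<omega> * U (Suc n) \<omega>)"
  shows "AE \<omega> in M. convergent (\<lambda>n. U n \<omega>)"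
proof -
  have UM [measurable]: "U n \<in> borel_measurable M" for n using adapted by (rule measurable_F_M)
  have UU_int [simp]: "integrable M (\<lambda>\<omega>. U m \<omega> * U n \<omega>)" for m n
    by (rule integrable_const_bound[where B = 1])
      (use bounded in \<open>auto intro!: AE_I2 simp: abs_mult mult_le_one\<close>)
  have U_int [simp]: "integrable M (U n)" for n
    by (rule integrable_const_bound[where B = 1]) (use bounded in \<open>auto intro!: AE_I2\<close>)
  define a where "a n = expectation (\<lambda>\<omega>. U n \<omega> * U n \<omega>)" for n
  have a_le_1: "a n \<le> 1" for n
  proof -
    have "a n \<le> expectation (\<lambda>\<omega>. 1)" unfolding a_def
      by (intro integral_mono UU_int) (use bounded in \<open>auto simp: mult_le_one\<close>)
    then show ?thesis by (simp add: prob_space)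
  qed
  have orth: "expectation (\<lambda>\<omega>. U n \<omega> * U n \<omega>) \<le> expectation (\<lambda>\<omega>. U n \<omega> * U (n + k) \<omega>)" for n k
  proof (induction k)
    case (Suc k)
    have "expectation (\<lambda>\<omega>. U n \<omega> * U (n + k) \<omega>) \<le> expectation (\<lambda>\<omega>. U n \<omega> * U (Suc (n + k)) \<omega>)"
      by (rule sub) (use bounded measurable_F_mono[OF adapted[of n], of "n + k"] in auto)
    with Suc show ?case by simp
  qed simp
  have sq_diff: "expectation (\<lambda>\<omega>. (U (n + k) \<omega> - U n \<omega>)\<^sup>2) \<le> a (n + k) - a n" for n k
  proof -
    have "expectation (\<lambda>\<omega>. (U (n + k) \<omega> - U n \<omega>)\<^sup>2)
      = expectation (\<lambda>\<omega>. U (n + k) \<omega> * U (n + k) \<omega> + U n \<omega> * U n \<omega> - 2 * (U n \<omega> * U (n + k) \<omega>))"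
      by (simp add: power2_eq_square algebra_simps)
    also have "\<dots> = a (n + k) + a n - 2 * expectation (\<lambda>\<omega>. U n \<omega> * U (n + k) \<omega>)"
      unfolding a_def by simp
    finally show ?thesis using orth[of n k] unfolding a_def by simp
  qed
  have a_mono: "a n \<le> a (n + k)" for n k
  proof -
    have "0 \<le> expectation (\<lambda>\<omega>. (U (n + k) \<omega> - U n \<omega>)\<^sup>2)" by (rule integral_nonneg_AE) simp
    then show ?thesis using sq_diff[of n k] by linarith
  qed
  have abs_diff: "expectation (\<lambda>\<omega>. \<bar>U (n + k) \<omega> - U n \<omega>\<bar>) \<le> sqrt (a (n + k) - a n)" for n k
  proof -
    let ?V = "\<lambda>\<omega>. \<bar>U (n + k) \<omega> - U n \<omega>\<bar>"
    have i2: "integrable M (\<lambda>\<omega>. (?V \<omega>)\<^sup>2)"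
    proof (rule integrable_const_bound[where B = 1])
      show "AE \<omega> in M. norm ((?V \<omega>)\<^sup>2) \<le> 1"
      proof (intro AE_I2)
        fix \<omega> assume "\<omega> \<in> space M"
        then have "?V \<omega> \<le> 1" using bounded[of \<omega> n] bounded[of \<omega> "n + k"] by linarith
        then show "norm ((?V \<omega>)\<^sup>2) \<le> 1" using power_mono[of "?V \<omega>" 1 2] by simp
      qed
    qed measurable
    have "0 \<le> variance ?V" by (rule variance_positive)
    also have "\<dots> = expectation (\<lambda>\<omega>. (?V \<omega>)\<^sup>2) - (expectation ?V)\<^sup>2"
      by (rule variance_eq) (use i2 in auto)
    finally have "(expectation ?V)\<^sup>2 \<le> a (n + k) - a n" using sq_diff[of n k] by simp
    then show ?thesis by (rule real_le_rsqrt)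
  qed
  have "incseq a" by (rule incseq_SucI) (use a_mono[of _ 1] in simp)
  then obtain \<alpha> where \<alpha>: "a \<longlonglongrightarrow> \<alpha>" "\<And>n. a n \<le> \<alpha>"
    using incseq_convergent[of a 1] a_le_1 by blast
  define osc where "osc \<epsilon> n = {\<omega>\<in>space M. \<exists>j\<ge>n. \<bar>U j \<omega> - U n \<omega>\<bar> \<ge> \<epsilon>}" for \<epsilon> n
  have osc_meas [measurable]: "osc \<epsilon> n \<in> events" for \<epsilon> n unfolding osc_def by measurable
  have osc: "\<epsilon> * prob (osc \<epsilon> n) \<le> 2 * sqrt (\<alpha> - a n)" if eps: "\<epsilon> > 0" for \<epsilon> n
  proof -
    define A where "A k = {\<omega>\<in>space M. \<exists>j\<in>{n..n+k}. \<bar>U j \<omega> - U n \<omega>\<bar> \<ge> \<epsilon>}" for k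
    have "A k \<in> events" for k unfolding A_def by measurable
    then have "(\<lambda>k. prob (A k)) \<longlonglongrightarrow> prob (\<Union>k. A k)"
      by (intro finite_Lim_measure_incseq) (auto simp: incseq_def A_def)
    also have "(\<Union>k. A k) = osc \<epsilon> n"
      unfolding A_def osc_def by (auto, metis le_add_diff_inverse atLeastAtMost_iff order_refl)
    finally have "(\<lambda>k. \<epsilon> * prob (A k)) \<longlonglongrightarrow> \<epsilon> * prob (osc \<epsilon> n)" by (intro tendsto_mult tendsto_const)
    moreover have "\<epsilon> * prob (A k) \<le> 2 * sqrt (\<alpha> - a n)" for k
    proof -
      have "\<epsilon> * prob (A k) \<le> 2 * expectation (\<lambda>\<omega>. \<bar>U (n + k) \<omega> - U n \<omega>\<bar>)"
        unfolding A_def by (rule bounded_submartingale_maximal[OF adapted bounded sub eps])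
      also have "\<dots> \<le> 2 * sqrt (\<alpha> - a n)"
        using abs_diff[of n k] real_sqrt_le_mono[of "a (n + k) - a n" "\<alpha> - a n"] \<alpha>(2)[of "n + k"] by linarith
      finally show ?thesis .
    qed
    ultimately show ?thesis by (intro LIMSEQ_le_const2) auto
  qed
  have AE_osc: "AE \<omega> in M. \<exists>n. \<forall>j\<ge>n. \<bar>U j \<omega> - U n \<omega>\<bar> < \<epsilon>" if eps: "\<epsilon> > 0" for \<epsilon>
  proof (rule AE_I[of _ _ "\<Inter>n. osc \<epsilon> n"])
    show "{\<omega> \<in> space M. \<not> (\<exists>n. \<forall>j\<ge>n. \<bar>U j \<omega> - U n \<omega>\<bar> < \<epsilon>)} \<subseteq> (\<Inter>n. osc \<epsilon> n)"
      unfolding osc_def by (auto simp: not_less)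
    show "(\<Inter>n. osc \<epsilon> n) \<in> events" by measurable
    have "(\<lambda>n. 2 * sqrt (\<alpha> - a n)) \<longlonglongrightarrow> 2 * sqrt (\<alpha> - \<alpha>)"
      by (intro tendsto_intros \<alpha>)
    moreover have "\<epsilon> * prob (\<Inter>n. osc \<epsilon> n) \<le> 2 * sqrt (\<alpha> - a n)" for n
    proof -
      have "prob (\<Inter>n. osc \<epsilon> n) \<le> prob (osc \<epsilon> n)" by (intro finite_measure_mono) auto
      then have "\<epsilon> * prob (\<Inter>n. osc \<epsilon> n) \<le> \<epsilon> * prob (osc \<epsilon> n)" using eps by (intro mult_left_mono) auto
      then show ?thesis using osc[OF eps, of n] by linarith
    qed
    ultimately have "\<epsilon> * prob (\<Inter>n. osc \<epsilon> n) \<le> 0"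
      using LIMSEQ_le_const[of "\<lambda>n. 2 * sqrt (\<alpha> - a n)" 0 "\<epsilon> * prob (\<Inter>n. osc \<epsilon> n)"] by auto
    then have "prob (\<Inter>n. osc \<epsilon> n) = 0"
      using eps by (simp add: mult_le_0_iff measure_le_0_iff)
    then show "emeasure M (\<Inter>n. osc \<epsilon> n) = 0" by (simp add: emeasure_eq_measure)
  qed
  have "AE \<omega> in M. \<forall>i::nat. \<exists>n. \<forall>j\<ge>n. \<bar>U j \<omega> - U n \<omega>\<bar> < 1 / real (Suc i)"
    unfolding AE_all_countable by (intro allI AE_osc) simp
  then show ?thesis
  proof (rule AE_mp, intro AE_I2 impI)
    fix \<omega> assume *: "\<forall>i::nat. \<exists>n. \<forall>j\<ge>n. \<bar>U j \<omega> - U n \<omega>\<bar> < 1 / real (Suc i)"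
    have "Cauchy (\<lambda>n. U n \<omega>)"
    proof (rule metric_CauchyI)
      fix e :: real assume "e > 0"
      then obtain i :: nat where i: "1 / real (Suc i) < e / 2"
        using nat_approx_posE[of "e / 2"] by auto
      from * obtain n where "\<forall>j\<ge>n. \<bar>U j \<omega> - U n \<omega>\<bar> < 1 / real (Suc i)" by blast
      then have n: "\<bar>U j \<omega> - U n \<omega>\<bar> < e / 2" if "j \<ge> n" for j using i that by fastforce
      show "\<exists>n. \<forall>j\<ge>n. \<forall>k\<ge>n. dist (U j \<omega>) (U k \<omega>) < e"
      proof (intro exI allI impI)
        fix j k assume "n \<le> j" "n \<le> k"
        then show "dist (U j \<omega>) (U k \<omega>) < e" using n[of j] n[of k] unfolding dist_real_def by linarith
      qed
    qed
    then show "convergent (\<lambda>n. U n \<omega>)" by (simp add: Cauchy_convergent_iff)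
  qed
qed

text \<open>
  The convergence of \<open>exp (- \<psi>)\<close> is stated, and not that of \<open>\<psi>\<close>, so that nothing has to be
  shown about finiteness of the limit of \<open>\<psi>\<close>. The submartingale property of \<open>exp (- \<psi>)\<close> is Jensen's
  inequality in the form \<open>exp (- y) - exp (- x) \<ge> exp (- x) (x - y)\<close>.
\<close>
theorem exp_minus_supermartingale_AE_convergent:
  fixes \<psi> :: "nat \<Rightarrow> 'a \<Rightarrow> real"
  assumes adapted: "\<And>n. \<psi> n \<in> borel_measurable (F n)"
    and nonneg: "\<And>n \<omega>. \<omega> \<in> space M \<Longrightarrow> 0 \<le> \<psi> n \<omega>"
    and int: "\<And>n. integrable M (\<psi> n)"
    and super: "\<And>n g. g \<in> borel_measurable (F n) \<Longrightarrow> (\<And>\<omega>. \<omega> \<in> space M \<Longrightarrow> 0 \<le> g \<omega> \<and> g \<omega> \<le> 1)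
        \<Longrightarrow> expectation (\<lambda>\<omega>. g \<omega> * (\<psi> (Suc n) \<omega> - \<psi> n \<omega>)) \<le> 0"
  shows "AE \<omega> in M. convergent (\<lambda>n. exp (- \<psi> n \<omega>))"
proof (rule bounded_submartingale_AE_convergent)
  show "(\<lambda>\<omega>. exp (- \<psi> n \<omega>)) \<in> borel_measurable (F n)" for n
    using adapted[of n] by measurable
  show "0 \<le> exp (- \<psi> n \<omega>) \<and> exp (- \<psi> n \<omega>) \<le> 1" if "\<omega> \<in> space M" for n \<omega>
    using nonneg[OF that] by simp
  fix n and g :: "'a \<Rightarrow> real" assume g: "g \<in> borel_measurable (F n)" "\<And>\<omega>. \<omega> \<in> space M \<Longrightarrow> 0 \<le> g \<omega> \<and> g \<omega> \<le> 1"
  have [measurable]: "g \<in> borel_measurable M" "\<psi> n \<in> borel_measurable M" for n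
    using g(1) adapted by (auto intro: measurable_F_M)
  have gU: "integrable M (\<lambda>\<omega>. g \<omega> * exp (- \<psi> i \<omega>))" for i
  proof (rule integrable_const_bound[where B = 1])
    show "AE \<omega> in M. norm (g \<omega> * exp (- \<psi> i \<omega>)) \<le> 1"
      using g(2) nonneg by (intro AE_I2) (auto simp: abs_mult intro!: mult_le_one)
  qed measurable
  let ?h = "\<lambda>\<omega>. g \<omega> * exp (- \<psi> n \<omega>)"
  have h: "?h \<in> borel_measurable (F n)" "\<And>\<omega>. \<omega> \<in> space M \<Longrightarrow> 0 \<le> ?h \<omega> \<and> ?h \<omega> \<le> 1"
    using g adapted[of n] nonneg by (measurable, auto intro!: mult_le_one)
  have h_int: "integrable M (\<lambda>\<omega>. ?h \<omega> * (\<psi> (Suc n) \<omega> - \<psi> n \<omega>))"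
  proof (rule Bochner_Integration.integrable_bound[OF Bochner_Integration.integrable_diff[OF int[of "Suc n"] int[of n]]])
    show "AE \<omega> in M. norm (?h \<omega> * (\<psi> (Suc n) \<omega> - \<psi> n \<omega>)) \<le> norm (\<psi> (Suc n) \<omega> - \<psi> n \<omega>)"
    proof (intro AE_I2)
      fix \<omega> assume "\<omega> \<in> space M"
      then have "\<bar>?h \<omega>\<bar> \<le> 1" using h(2) by (simp only: abs_of_nonneg)
      then show "norm (?h \<omega> * (\<psi> (Suc n) \<omega> - \<psi> n \<omega>)) \<le> norm (\<psi> (Suc n) \<omega> - \<psi> n \<omega>)"
        unfolding real_norm_def abs_mult[of "?h \<omega>"] by (intro mult_left_le_one_le) auto
    qed
  qed measurable
  have "0 \<le> - expectation (\<lambda>\<omega>. ?h \<omega> * (\<psi> (Suc n) \<omega> - \<psi> n \<omega>))"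
    using super[OF h] by simp
  also have "\<dots> = expectation (\<lambda>\<omega>. - (?h \<omega> * (\<psi> (Suc n) \<omega> - \<psi> n \<omega>)))" by simp
  also have "\<dots> \<le> expectation (\<lambda>\<omega>. g \<omega> * exp (- \<psi> (Suc n) \<omega>) - g \<omega> * exp (- \<psi> n \<omega>))"
  proof (intro integral_mono Bochner_Integration.integrable_minus h_int Bochner_Integration.integrable_diff gU)
    fix \<omega> assume w: "\<omega> \<in> space M"
    have "1 + (\<psi> n \<omega> - \<psi> (Suc n) \<omega>) \<le> exp (\<psi> n \<omega> - \<psi> (Suc n) \<omega>)" by (rule exp_ge_add_one_self)
    then have "exp (- \<psi> n \<omega>) * (\<psi> n \<omega> - \<psi> (Suc n) \<omega>)
        \<le> exp (- \<psi> n \<omega>) * (exp (\<psi> n \<omega> - \<psi> (Suc n) \<omega>) - 1)"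
      by (intro mult_left_mono exp_ge_zero) linarith
    also have "\<dots> = exp (- \<psi> (Suc n) \<omega>) - exp (- \<psi> n \<omega>)"
      by (simp add: right_diff_distrib flip: exp_add)
    finally have "g \<omega> * (exp (- \<psi> n \<omega>) * (\<psi> n \<omega> - \<psi> (Suc n) \<omega>))
        \<le> g \<omega> * (exp (- \<psi> (Suc n) \<omega>) - exp (- \<psi> n \<omega>))"
      using g(2)[OF w] by (intro mult_left_mono) auto
    then show "- (?h \<omega> * (\<psi> (Suc n) \<omega> - \<psi> n \<omega>)) \<le> g \<omega> * exp (- \<psi> (Suc n) \<omega>) - g \<omega> * exp (- \<psi> n \<omega>)"
      by (simp add: algebra_simps)
  qed
  also have "\<dots> = expectation (\<lambda>\<omega>. g \<omega> * exp (- \<psi> (Suc n) \<omega>)) - expectation (\<lambda>\<omega>. g \<omega> * exp (- \<psi> n \<omega>))"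
    by (rule Bochner_Integration.integral_diff[OF gU gU])
  finally show "expectation (\<lambda>\<omega>. g \<omega> * exp (- \<psi> n \<omega>)) \<le> expectation (\<lambda>\<omega>. g \<omega> * exp (- \<psi> (Suc n) \<omega>))"
    by simp
qed

section \<open>A strong law of large numbers for dependent summands\<close>

text \<open>
  The centered summands are orthogonal, so the second moment of the \<open>n\<close>-th partial sum is \<open>O(n)\<close> and
  the averages converge along the squares. Nonnegativity of \<open>a\<close> and boundedness of \<open>c\<close> fill the
  gaps between the squares.
\<close>
theorem average_minus_cond_exp_AE_tendsto_0:
  fixes a c :: "nat \<Rightarrow> 'a \<Rightarrow> real"
  assumes a_adapted: "\<And>n. a n \<in> borel_measurable (F (Suc n))"
    and a_nonneg: "\<And>n \<omega>. \<omega> \<in> space M \<Longrightarrow> 0 \<le> a n \<omega>"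
    and a_sq: "\<And>n. integrable M (\<lambda>\<omega>. (a n \<omega>)\<^sup>2)" "\<And>n. expectation (\<lambda>\<omega>. (a n \<omega>)\<^sup>2) \<le> B"
    and c_adapted: "\<And>n. c n \<in> borel_measurable (F n)"
    and c_cond: "\<And>n. AE \<omega> in M. real_cond_exp M (F n) (a n) \<omega> = c n \<omega>"
    and c_bounds: "\<And>n. AE \<omega> in M. 0 \<le> c n \<omega> \<and> c n \<omega> \<le> C"
  shows "AE \<omega> in M. (\<lambda>n. (\<Sum>i<n. a i \<omega> - c i \<omega>) / real n) \<longlonglongrightarrow> 0"
proof -
  have [measurable]: "a n \<in> borel_measurable M" "c n \<in> borel_measurable M" for n
    using a_adapted c_adapted by (auto intro: measurable_F_M)
  have c_sq: "AE \<omega> in M. (c n \<omega>)\<^sup>2 \<le> C\<^sup>2" for n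
    using c_bounds[of n] by eventually_elim (auto intro: power_mono)
  have c_sq_int: "integrable M (\<lambda>\<omega>. (c n \<omega>)\<^sup>2)" for n
    by (rule integrable_const_bound[where B = "C\<^sup>2"]) (use c_sq in auto)
  define Y where "Y n \<omega> = a n \<omega> - c n \<omega>" for n \<omega>
  define S where "S n \<omega> = (\<Sum>i<n. Y i \<omega>)" for n \<omega>
  have [measurable]: "Y n \<in> borel_measurable M" for n unfolding Y_def by measurable
  have [measurable]: "S n \<in> borel_measurable M" for n unfolding S_def by measurable
  have S_adapted: "S n \<in> borel_measurable (F n)" for n
  proof -
    have "Y i \<in> borel_measurable (F n)" if "i \<in> {..<n}" for i
    proof -
      have [measurable]: "a i \<in> borel_measurable (F n)" "c i \<in> borel_measurable (F n)"
        using that measurable_F_mono[OF a_adapted[of i], of n] measurable_F_mono[OF c_adapted[of i], of n]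
        by auto
      show ?thesis unfolding Y_def by measurable
    qed
    then show ?thesis unfolding S_def by (intro borel_measurable_sum) auto
  qed
  have Y_sq_le: "(Y n \<omega>)\<^sup>2 \<le> 2 * (a n \<omega>)\<^sup>2 + 2 * (c n \<omega>)\<^sup>2" for n \<omega>
    using zero_le_power2[of "a n \<omega> + c n \<omega>"] unfolding Y_def by (simp add: power2_eq_square algebra_simps)
  have Y_sq_bound_int: "integrable M (\<lambda>\<omega>. 2 * (a n \<omega>)\<^sup>2 + 2 * (c n \<omega>)\<^sup>2)" for n
    using a_sq(1) c_sq_int by auto
  have Y_sq_int: "integrable M (\<lambda>\<omega>. (Y n \<omega>)\<^sup>2)" for n
    by (rule Bochner_Integration.integrable_bound[OF Y_sq_bound_int[of n]])
      (use Y_sq_le in \<open>auto intro!: AE_I2\<close>)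
  have prod_int: "integrable M (\<lambda>\<omega>. f \<omega> * g \<omega>)"
    if "f \<in> borel_measurable M" "g \<in> borel_measurable M"
      "integrable M (\<lambda>\<omega>. (f \<omega>)\<^sup>2)" "integrable M (\<lambda>\<omega>. (g \<omega>)\<^sup>2)" for f g :: "'a \<Rightarrow> real"
  proof (rule Bochner_Integration.integrable_bound[OF Bochner_Integration.integrable_add[OF that(3,4)]])
    show "(\<lambda>\<omega>. f \<omega> * g \<omega>) \<in> borel_measurable M" using that by measurable
    have "\<bar>x * y\<bar> \<le> x\<^sup>2 + y\<^sup>2" for x y :: real
    proof -
      have "0 \<le> (\<bar>x\<bar> - \<bar>y\<bar>)\<^sup>2" by simp
      then have "2 * (\<bar>x\<bar> * \<bar>y\<bar>) \<le> x\<^sup>2 + y\<^sup>2" by (simp add: power2_diff algebra_simps)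
      moreover have "0 \<le> \<bar>x\<bar> * \<bar>y\<bar>" by simp
      ultimately show ?thesis unfolding abs_mult by linarith
    qed
    then show "AE \<omega> in M. norm (f \<omega> * g \<omega>) \<le> norm ((f \<omega>)\<^sup>2 + (g \<omega>)\<^sup>2)"
      by (intro AE_I2) (simp add: order.trans[OF _ abs_ge_self])
  qed
  have B: "0 \<le> B"
  proof -
    have "0 \<le> expectation (\<lambda>\<omega>. (a 0 \<omega>)\<^sup>2)" by (rule integral_nonneg_AE) simp
    then show ?thesis using a_sq(2)[of 0] by linarith
  qed
  define D where "D = 2 * B + 2 * C\<^sup>2"
  have D: "D \<ge> 0" using B unfolding D_def by simp
  have Y_sq: "expectation (\<lambda>\<omega>. (Y n \<omega>)\<^sup>2) \<le> D" for n
  proof -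
    have "expectation (\<lambda>\<omega>. (Y n \<omega>)\<^sup>2) \<le> expectation (\<lambda>\<omega>. 2 * (a n \<omega>)\<^sup>2 + 2 * (c n \<omega>)\<^sup>2)"
      by (intro integral_mono Y_sq_int Y_sq_bound_int Y_sq_le)
    also have "\<dots> = 2 * expectation (\<lambda>\<omega>. (a n \<omega>)\<^sup>2) + 2 * expectation (\<lambda>\<omega>. (c n \<omega>)\<^sup>2)"
      using a_sq(1) c_sq_int by simp
    also have "expectation (\<lambda>\<omega>. (c n \<omega>)\<^sup>2) \<le> expectation (\<lambda>\<omega>. C\<^sup>2)"
      by (intro integral_mono_AE c_sq_int c_sq) simp
    also have "expectation (\<lambda>\<omega>. C\<^sup>2) = C\<^sup>2" by (simp add: prob_space)
    finally show ?thesis using a_sq(2)[of n] unfolding D_def by simp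
  qed
  have S_sq: "integrable M (\<lambda>\<omega>. (S n \<omega>)\<^sup>2) \<and> expectation (\<lambda>\<omega>. (S n \<omega>)\<^sup>2) \<le> n * D" for n
  proof (induction n)
    case 0
    then show ?case by (simp add: S_def)
  next
    case (Suc n)
    interpret sub: sigma_finite_subalgebra M "F n"
      by (intro finite_measure_subalgebra_is_sigma_finite finite_measure_subalgebra.intro
          finite_measure_subalgebra_axioms.intro subalg finite_measure_axioms)
    have Sa: "integrable M (\<lambda>\<omega>. S n \<omega> * a n \<omega>)"
      by (rule prod_int) (use Suc a_sq in auto)
    have SY: "integrable M (\<lambda>\<omega>. S n \<omega> * Y n \<omega>)"
      by (rule prod_int) (use Suc Y_sq_int in auto)
    have Sc: "integrable M (\<lambda>\<omega>. S n \<omega> * c n \<omega>)"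
      by (rule prod_int) (use Suc c_sq_int in auto)
    have "expectation (\<lambda>\<omega>. S n \<omega> * c n \<omega>) = expectation (\<lambda>\<omega>. S n \<omega> * real_cond_exp M (F n) (a n) \<omega>)"
      by (rule integral_cong_AE) (use c_cond[of n] in auto)
    also have "\<dots> = expectation (\<lambda>\<omega>. S n \<omega> * a n \<omega>)"
      by (rule sub.real_cond_exp_intg(2)[OF Sa S_adapted]) measurable
    finally have orth: "expectation (\<lambda>\<omega>. S n \<omega> * Y n \<omega>) = 0"
      unfolding Y_def right_diff_distrib using Sa Sc by simp
    have eq: "(S (Suc n) \<omega>)\<^sup>2 = (S n \<omega>)\<^sup>2 + 2 * (S n \<omega> * Y n \<omega>) + (Y n \<omega>)\<^sup>2" for \<omega>
      unfolding S_def by (simp add: power2_sum)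
    have "expectation (\<lambda>\<omega>. (S (Suc n) \<omega>)\<^sup>2)
        = expectation (\<lambda>\<omega>. (S n \<omega>)\<^sup>2) + 2 * expectation (\<lambda>\<omega>. S n \<omega> * Y n \<omega>) + expectation (\<lambda>\<omega>. (Y n \<omega>)\<^sup>2)"
      unfolding eq using Suc SY Y_sq_int by simp
    also have "\<dots> \<le> Suc n * D" using Suc Y_sq[of n] orth by (simp add: algebra_simps)
    finally show ?case unfolding eq using Suc SY Y_sq_int by simp
  qed
  define f where "f j \<omega> = (S ((Suc j)\<^sup>2) \<omega> / real ((Suc j)\<^sup>2))\<^sup>2" for j \<omega>
  have f_int: "integrable M (f j)" for j
    using S_sq unfolding f_def power_divide by auto
  have f_exp: "expectation (f j) \<le> D * inverse ((real (Suc j))\<^sup>2)" for j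
  proof -
    have "expectation (f j) = expectation (\<lambda>\<omega>. (S ((Suc j)\<^sup>2) \<omega>)\<^sup>2) / (real ((Suc j)\<^sup>2))\<^sup>2"
      unfolding f_def power_divide by simp
    also have "\<dots> \<le> (real ((Suc j)\<^sup>2) * D) / (real ((Suc j)\<^sup>2))\<^sup>2"
      using S_sq[of "(Suc j)\<^sup>2"] by (intro divide_right_mono) (blast, simp)
    also have "\<dots> = D * inverse ((real (Suc j))\<^sup>2)"
      unfolding of_nat_power by (simp add: power2_eq_square field_simps del: of_nat_Suc)
    finally show ?thesis .
  qed
  have summ: "summable (\<lambda>j. D * inverse ((real (Suc j))\<^sup>2))"
    using inverse_power_summable[of 2, where 'a=real]
    by (intro summable_mult) (subst summable_Suc_iff, simp)
  have "AE \<omega> in M. summable (\<lambda>j. f j \<omega>)"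
  proof (rule AE_summable_if_sum_expectation_bounded[OF f_int])
    show "f n \<omega> \<ge> 0" for n \<omega> unfolding f_def by simp
    show "(\<Sum>j<n. expectation (f j)) \<le> (\<Sum>j. D * inverse ((real (Suc j))\<^sup>2))" for n
      by (rule order.trans[OF sum_mono[OF f_exp] sum_le_suminf[OF summ]]) (use D in auto)
  qed
  moreover have "AE \<omega> in M. \<forall>n. 0 \<le> c n \<omega> \<and> c n \<omega> \<le> C"
    unfolding AE_all_countable using c_bounds by blast
  ultimately show ?thesis
  proof (rule AE_mp[OF AE_conjI], intro AE_I2 impI)
    fix \<omega> assume w: "\<omega> \<in> space M" "summable (\<lambda>j. f j \<omega>) \<and> (\<forall>n. 0 \<le> c n \<omega> \<and> c n \<omega> \<le> C)"
    then have "(\<lambda>j. f j \<omega>) \<longlonglongrightarrow> 0" using summable_LIMSEQ_zero by blast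
    then have "(\<lambda>j. S ((Suc j)\<^sup>2) \<omega> / real ((Suc j)\<^sup>2)) \<longlonglongrightarrow> 0"
      unfolding f_def by (simp add: power_tendsto_0_iff)
    then have "(\<lambda>j. S (j\<^sup>2) \<omega> / real (j\<^sup>2)) \<longlonglongrightarrow> 0"
      by (rule LIMSEQ_imp_Suc)
    then show "(\<lambda>n. (\<Sum>i<n. a i \<omega> - c i \<omega>) / real n) \<longlonglongrightarrow> 0"
      unfolding S_def Y_def
      by (intro tendsto_average_from_squares[where C = C]) (use a_nonneg w in auto)
  qed
qed

end

section \<open>Independent sigma-algebras\<close>

lemma (in prob_space) indep_set_expectation_mult:
  fixes f g :: "'a \<Rightarrow> real"
  assumes ind: "indep_set (sets G) (sets H)"
    and sub: "subalgebra M G" "subalgebra M H"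
    and f: "f \<in> borel_measurable G" "integrable M f"
    and g: "g \<in> borel_measurable H" "integrable M g"
  shows "integrable M (\<lambda>\<omega>. f \<omega> * g \<omega>)"
    and "expectation (\<lambda>\<omega>. f \<omega> * g \<omega>) = expectation f * expectation g"
proof -
  have space: "space G = space M" "space H = space M" using sub unfolding subalgebra_def by auto
  have gen: "sigma_sets (space M) {u -` A \<inter> space M | A. A \<in> sets borel} \<subseteq> sets K"
    if "u \<in> borel_measurable K" "space K = space M" for u :: "'a \<Rightarrow> real" and K
  proof -
    have "{u -` A \<inter> space M | A. A \<in> sets borel} \<subseteq> sets K"
      using measurable_sets[OF that(1)] that(2) by auto
    then show ?thesis using sets.sigma_sets_subset[of _ K] that(2) by simp
  qed
  have "indep_var borel f borel g"
    unfolding indep_var_eq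
  proof (intro conjI)
    show "random_variable borel f" "random_variable borel g" using f g by auto
    show "indep_set (sigma_sets (space M) {f -` A \<inter> space M | A. A \<in> sets borel})
      (sigma_sets (space M) {g -` A \<inter> space M | A. A \<in> sets borel})"
      using ind gen[OF f(1) space(1)] gen[OF g(1) space(2)]
      unfolding indep_set_def by (elim indep_sets_mono_sets) (auto split: bool.split)
  qed
  then show "integrable M (\<lambda>\<omega>. f \<omega> * g \<omega>)"
    "expectation (\<lambda>\<omega>. f \<omega> * g \<omega>) = expectation f * expectation g"
    using f g by (auto intro: indep_var_integrable indep_var_lebesgue_integral)
qed

lemma space_sigma_of [simp]: "space (sigma_of M Ys) = space M"
  unfolding sigma_of_def by (simp add: space_measure_of_conv)

lemma sets_sigma_of: "sets (sigma_of M Ys) = sigma_sets (space M) {Y -` B \<inter> space M | Y B. Y \<in> Ys}"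
  unfolding sigma_of_def by (rule sets_measure_of) auto

lemma measurable_sigma_of: "Y \<in> Ys \<Longrightarrow> Y \<in> measurable (sigma_of M Ys) (count_space UNIV)"
proof (rule measurableI)
  fix B assume "Y \<in> Ys"
  then show "Y -` B \<inter> space (sigma_of M Ys) \<in> sets (sigma_of M Ys)"
    unfolding sets_sigma_of space_sigma_of by (intro sigma_sets.Basic) blast
qed simp

lemma sets_sigma_of_mono: "Ys \<subseteq> Zs \<Longrightarrow> sets (sigma_of M Ys) \<subseteq> sets (sigma_of M Zs)"
  unfolding sets_sigma_of by (rule sigma_sets_mono') blast

lemma subalgebra_sigma_of_mono: "Ys \<subseteq> Zs \<Longrightarrow> subalgebra (sigma_of M Zs) (sigma_of M Ys)"
  unfolding subalgebra_def by (simp add: sets_sigma_of_mono)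

lemma subalgebra_sigma_of:
  assumes "\<And>Y. Y \<in> Ys \<Longrightarrow> Y \<in> measurable M (count_space UNIV)"
  shows "subalgebra M (sigma_of M Ys)"
  unfolding subalgebra_def sets_sigma_of
proof (intro conjI sets.sigma_sets_subset)
  show "{Y -` B \<inter> space M | Y B. Y \<in> Ys} \<subseteq> sets M"
    using measurable_sets[OF assms] by auto
qed simp

section \<open>Conditional means in the urn model\<close>

context randomly_reinforced_urn
begin

text \<open>
  Real-valued versions of \<open>H\<close> and \<open>S\<close>, the shares \<open>Z\<close>, the sigma-algebras of the past, and, as
  \<open>GX n\<close>, the sigma-algebra of everything known just before the replacement matrix of stage \<open>n + 1\<close>.
\<close>

abbreviation "balls n k \<omega> \<equiv> real (urn_H H0 X A n k \<omega>)"
abbreviation "contents n \<omega> \<equiv> real (urn_S d H0 X A n \<omega>)"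
abbreviation "share n k \<omega> \<equiv> urn_Z d H0 X A n k \<omega>"
abbreviation "F n \<equiv> urn_F M d N X A n"
abbreviation "G n \<equiv> urn_G M d N X A n"
abbreviation "GX n \<equiv> sigma_of M (urn_history d N X A n \<union> {N (Suc n)} \<union> {X (Suc n) k | k. k \<in> {1..d}})"

lemma history_measurable: "Y \<in> urn_history d N X A n \<Longrightarrow> Y \<in> measurable M (count_space UNIV)"
  unfolding urn_history_def using N_measurable X_measurable A_measurable by auto

lemma subalgebras: "subalgebra M (F n)" "subalgebra M (G n)" "subalgebra M (GX n)"
  "subalgebra M (sigma_of M {A (Suc n) k | k. k \<in> {1..d}})"
  unfolding urn_F_def urn_G_def
  by (intro subalgebra_sigma_of; use history_measurable N_measurable X_measurable A_measurable in auto)+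

lemma measurable_F_G:
  assumes "f \<in> measurable (F n) K" shows "f \<in> measurable (G n) K"
  by (rule measurable_from_subalg[OF _ assms])
    (unfold urn_F_def urn_G_def, rule subalgebra_sigma_of_mono, blast)

lemma measurable_G_GX:
  assumes "f \<in> measurable (G n) K" shows "f \<in> measurable (GX n) K"
  by (rule measurable_from_subalg[OF _ assms])
    (unfold urn_G_def, rule subalgebra_sigma_of_mono, blast)

sublocale discrete_filtration M "\<lambda>n. F n"
proof
  fix n
  show "subalgebra M (F n)" by (rule subalgebras)
  show "sets (F n) \<subseteq> sets (F (Suc n))"
    unfolding urn_F_def 
  proof (rule sets_sigma_of_mono)
    have "{1..n} \<subseteq> {1..Suc n}" by auto
    then show "urn_history d N X A n \<subseteq> urn_history d N X A (Suc n)"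
      unfolding urn_history_def by blast
  qed
qed

lemma F_measurable:
  assumes "i \<in> {1..n}" "k \<in> {1..d}"
  shows "X i k \<in> measurable (F n) (count_space UNIV)" "A i k \<in> measurable (F n) (count_space UNIV)"
    "N i \<in> measurable (F n) (count_space UNIV)"
  unfolding urn_F_def using assms by (auto intro!: measurable_sigma_of simp: urn_history_def)

text \<open>The detour through the real numbers makes the measurability of sums and products available.\<close>
lemma urn_H_F_measurable:
  assumes "k \<in> {1..d}"
  shows "urn_H H0 X A n k \<in> measurable (F n) (count_space UNIV)"
proof -
  have "(\<lambda>\<omega>. real (A i k \<omega>) * real (X i k \<omega>)) \<in> borel_measurable (F n)" if "i \<in> {1..n}" for i
  proof -
    have [measurable]: "X i k \<in> measurable (F n) (count_space UNIV)" "A i k \<in> measurable (F n) (count_space UNIV)"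
      using F_measurable that assms by auto
    show ?thesis by measurable
  qed
  then have "(\<lambda>\<omega>. nat \<lfloor>real (H0 k) + (\<Sum>i=1..n. real (A i k \<omega>) * real (X i k \<omega>))\<rfloor>)
      \<in> measurable (F n) (count_space UNIV)"
    by measurable
  also have "(\<lambda>\<omega>. nat \<lfloor>real (H0 k) + (\<Sum>i=1..n. real (A i k \<omega>) * real (X i k \<omega>))\<rfloor>) = urn_H H0 X A n k"
  proof
    fix \<omega>
    have "real (H0 k) + (\<Sum>i=1..n. real (A i k \<omega>) * real (X i k \<omega>)) = real (urn_H H0 X A n k \<omega>)"
      unfolding urn_H_def by simp
    then show "nat \<lfloor>real (H0 k) + (\<Sum>i=1..n. real (A i k \<omega>) * real (X i k \<omega>))\<rfloor> = urn_H H0 X A n k \<omega>"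
      by simp
  qed
  finally show ?thesis .
qed

lemma balls_F_measurable: "k \<in> {1..d} \<Longrightarrow> (\<lambda>\<omega>. balls n k \<omega>) \<in> borel_measurable (F n)"
  by (rule measurable_compose[OF urn_H_F_measurable]) auto

lemma contents_eq_sum: "contents n \<omega> = (\<Sum>k=1..d. balls n k \<omega>)"
  unfolding urn_S_def by simp

lemma contents_F_measurable: "(\<lambda>\<omega>. contents n \<omega>) \<in> borel_measurable (F n)"
  unfolding contents_eq_sum by (intro borel_measurable_sum balls_F_measurable)

lemma share_F_measurable: "k \<in> {1..d} \<Longrightarrow> (\<lambda>\<omega>. share n k \<omega>) \<in> borel_measurable (F n)"
  unfolding urn_Z_def using balls_F_measurable contents_F_measurable by measurable

lemma draw_le: assumes "\<omega> \<in> space M" "k \<in> {1..d}" shows "X (Suc n) k \<omega> \<le> N (Suc n) \<omega>" "X (Suc n) k \<omega> \<le> C1"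
proof -
  have "X (Suc n) k \<omega> \<le> (\<Sum>k=1..d. X (Suc n) k \<omega>)" by (rule member_le_sum) (use assms in auto)
  then show "X (Suc n) k \<omega> \<le> N (Suc n) \<omega>" using X_sum[of "Suc n" \<omega>] assms by simp
  then show "X (Suc n) k \<omega> \<le> C1" using N_range[OF assms(1), of n] by simp
qed

lemma balls_Suc: "balls (Suc n) k \<omega> = balls n k \<omega> + real (A (Suc n) k \<omega>) * real (X (Suc n) k \<omega>)"
  unfolding urn_H_def by simp

lemma contents_Suc: "contents (Suc n) \<omega> = contents n \<omega> + (\<Sum>k=1..d. real (A (Suc n) k \<omega>) * real (X (Suc n) k \<omega>))"
  unfolding contents_eq_sum balls_Suc by (simp add: sum.distrib)

lemma balls_ge_1: "k \<in> {1..d} \<Longrightarrow> balls n k \<omega> \<ge> 1"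
proof -
  assume "k \<in> {1..d}"
  then have "1 \<le> urn_H H0 X A n k \<omega>" unfolding urn_H_def using H0_pos[of k] by simp
  then show ?thesis by simp
qed

lemma balls_le_contents: "k \<in> {1..d} \<Longrightarrow> balls n k \<omega> \<le> contents n \<omega>"
  unfolding contents_eq_sum by (rule member_le_sum) auto

lemma contents_ge_1: "contents n \<omega> \<ge> 1"
  using balls_ge_1[of 1 n \<omega>] balls_le_contents[of 1 n \<omega>] d_ge_2 by simp

lemma share_bounds: assumes "k \<in> {1..d}" shows "0 \<le> share n k \<omega>" "share n k \<omega> \<le> 1"
  using balls_le_contents[OF assms, of n \<omega>] contents_ge_1[of n \<omega>] unfolding urn_Z_def by (auto simp: divide_le_eq_1)

lemma sum_share: "(\<Sum>k=1..d. share n k \<omega>) = 1"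
  using contents_ge_1[of n \<omega>] unfolding urn_Z_def sum_divide_distrib[symmetric] contents_eq_sum[symmetric] by simp

lemma draw_count_bounds:
  assumes "\<omega> \<in> space M" shows "1 \<le> real (N (Suc n) \<omega>)" "real (N (Suc n) \<omega>) \<le> real C1"
  using N_range[OF assms, of n] by auto

text \<open>
  The conditional mean of a draw given \<open>G n\<close>, obtained by summing the conditional probabilities over the finitely many
  vectors that can be drawn.
\<close>
lemma expectation_draw:
  assumes k: "k \<in> {1..d}" and g: "g \<in> borel_measurable (G n)" "integrable M g"
  shows "integrable M (\<lambda>\<omega>. g \<omega> * real (X (Suc n) k \<omega>))"
    and "expectation (\<lambda>\<omega>. g \<omega> * real (X (Suc n) k \<omega>))
      = expectation (\<lambda>\<omega>. g \<omega> * (real (N (Suc n) \<omega>) * share n k \<omega>))"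
proof -
  define P where "P = Pi\<^sub>E {1..d} (\<lambda>_. {..C1})"
  define E where "E x = {\<omega> \<in> space M. \<forall>k\<in>{1..d}. X (Suc n) k \<omega> = x k}" for x
  have P: "finite P" unfolding P_def by (intro finite_PiE) auto
  have [measurable]: "X (Suc n) k \<in> measurable M (count_space UNIV)" if "k \<in> {1..d}" for k
    using X_measurable that by simp
  have [measurable]: "N (Suc n) \<in> measurable M (count_space UNIV)" using N_measurable by simp
  have E [measurable]: "E x \<in> events" for x unfolding E_def by measurable
  have [measurable]: "g \<in> borel_measurable M" using g by auto
  have [measurable]: "(\<lambda>\<omega>. share n k \<omega>) \<in> borel_measurable M"
    by (rule measurable_F_M[OF share_F_measurable[OF k]])
  have [measurable]: "X (Suc n) k \<in> measurable M (count_space UNIV)" using X_measurable k by simp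
  show "integrable M (\<lambda>\<omega>. g \<omega> * real (X (Suc n) k \<omega>))"
  proof (rule Bochner_Integration.integrable_bound[OF integrable_mult_left[OF g(2), of "real C1"]])
    show "AE \<omega> in M. norm (g \<omega> * real (X (Suc n) k \<omega>)) \<le> norm (g \<omega> * real C1)"
      using draw_le(2)[OF _ k, of _ n] by (intro AE_I2) (auto simp: abs_mult intro!: mult_left_mono)
  qed measurable
  interpret sub: sigma_finite_subalgebra M "G n"
    by (intro finite_measure_subalgebra_is_sigma_finite finite_measure_subalgebra.intro
        finite_measure_subalgebra_axioms.intro subalgebras finite_measure_axioms)
  have gE: "integrable M (\<lambda>\<omega>. g \<omega> * indicator (E x) \<omega>)" for x
    using integrable_mult_indicator[OF E g(2)] by (simp add: mult.commute)
  note cond = sub.real_cond_exp_intg[OF gE g(1) borel_measurable_indicator[OF E]]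
  \<comment> \<open>Exactly one of the events \<open>E x\<close> occurs, the one given by the drawn vector.\<close>
  have X_eq: "real (X (Suc n) k \<omega>) = (\<Sum>x\<in>P. real (x k) * indicator (E x) \<omega>)" if w: "\<omega> \<in> space M" for \<omega>
  proof -
    define x0 where "x0 = restrict (\<lambda>j. X (Suc n) j \<omega>) {1..d}"
    have x0: "x0 \<in> P" unfolding x0_def P_def using draw_le(2)[OF w] by auto
    have "indicator (E x) \<omega> = (if x = x0 then 1 else 0 :: real)" if "x \<in> P" for x
    proof -
      have "\<omega> \<in> E x \<longleftrightarrow> x = x0"
        using that w unfolding E_def P_def x0_def by (auto simp: PiE_iff extensional_def fun_eq_iff)
      then show ?thesis by (simp add: indicator_def)
    qed
    then have "(\<Sum>x\<in>P. real (x k) * indicator (E x) \<omega>) = (\<Sum>x\<in>P. if x = x0 then real (x0 k) else 0)"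
      by (intro sum.cong) auto
    also have "\<dots> = real (x0 k)" using P x0 by simp
    finally show ?thesis using k unfolding x0_def by simp
  qed
  have "expectation (\<lambda>\<omega>. g \<omega> * real (X (Suc n) k \<omega>))
      = expectation (\<lambda>\<omega>. \<Sum>x\<in>P. real (x k) * (g \<omega> * indicator (E x) \<omega>))"
    by (intro Bochner_Integration.integral_cong) (auto simp: X_eq sum_distrib_left mult_ac)
  also have "\<dots> = (\<Sum>x\<in>P. real (x k) * expectation (\<lambda>\<omega>. g \<omega> * indicator (E x) \<omega>))"
    using gE by simp
  also have "\<dots> = (\<Sum>x\<in>P. real (x k) * expectation (\<lambda>\<omega>. g \<omega> * real_cond_exp M (G n) (indicator (E x)) \<omega>))"
    by (simp add: cond(2))
  also have "\<dots> = expectation (\<lambda>\<omega>. \<Sum>x\<in>P. real (x k) * (g \<omega> * real_cond_exp M (G n) (indicator (E x)) \<omega>))"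
    using cond(1) by simp
  also have "\<dots> = expectation (\<lambda>\<omega>. g \<omega> * (real (N (Suc n) \<omega>) * share n k \<omega>))"
  proof (rule integral_cong_AE)
    have "AE \<omega> in M. \<forall>x\<in>P. real_cond_exp M (G n) (indicator (E x)) \<omega>
        = mv_hypergeometric d (urn_S d H0 X A n \<omega>) (N (Suc n) \<omega>) (\<lambda>k. urn_H H0 X A n k \<omega>) x"
      using P X_hypergeometric[of n] unfolding E_def by (intro AE_finite_allI) auto
    then show "AE \<omega> in M. (\<Sum>x\<in>P. real (x k) * (g \<omega> * real_cond_exp M (G n) (indicator (E x)) \<omega>))
        = g \<omega> * (real (N (Suc n) \<omega>) * share n k \<omega>)"
    proof (rule AE_mp, intro AE_I2 impI)
      fix \<omega> assume w: "\<omega> \<in> space M" and *: "\<forall>x\<in>P. real_cond_exp M (G n) (indicator (E x)) \<omega>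
        = mv_hypergeometric d (urn_S d H0 X A n \<omega>) (N (Suc n) \<omega>) (\<lambda>k. urn_H H0 X A n k \<omega>) x"
      have "(\<Sum>x\<in>P. real (x k) * (g \<omega> * real_cond_exp M (G n) (indicator (E x)) \<omega>))
        = g \<omega> * (\<Sum>x\<in>P. real (x k) * mv_hypergeometric d (urn_S d H0 X A n \<omega>) (N (Suc n) \<omega>)
            (\<lambda>k. urn_H H0 X A n k \<omega>) x)"
        using * by (simp add: sum_distrib_left mult_ac)
      also have "\<dots> = g \<omega> * (real (N (Suc n) \<omega>) * share n k \<omega>)"
        unfolding P_def urn_Z_def
        by (subst mv_hypergeometric_mean[OF k]) (use N_range[OF w, of n] in \<open>auto simp: urn_S_def\<close>)
      finally show "(\<Sum>x\<in>P. real (x k) * (g \<omega> * real_cond_exp M (G n) (indicator (E x)) \<omega>))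
        = g \<omega> * (real (N (Suc n) \<omega>) * share n k \<omega>)" .
    qed
  qed measurable
  finally show "expectation (\<lambda>\<omega>. g \<omega> * real (X (Suc n) k \<omega>))
      = expectation (\<lambda>\<omega>. g \<omega> * (real (N (Suc n) \<omega>) * share n k \<omega>))" .
qed

lemma expectation_reinforcement:
  fixes f :: "nat \<Rightarrow> real"
  assumes k: "k \<in> {1..d}" and g: "g \<in> borel_measurable (G n)" "integrable M g"
    and f: "integrable M (\<lambda>\<omega>. f (A (Suc n) k \<omega>))"
  shows "integrable M (\<lambda>\<omega>. g \<omega> * (f (A (Suc n) k \<omega>) * real (X (Suc n) k \<omega>)))"
    and "expectation (\<lambda>\<omega>. g \<omega> * (f (A (Suc n) k \<omega>) * real (X (Suc n) k \<omega>)))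
      = expectation (\<lambda>\<omega>. f (A (Suc n) k \<omega>)) * expectation (\<lambda>\<omega>. g \<omega> * (real (N (Suc n) \<omega>) * share n k \<omega>))"
proof -
  have fA: "(\<lambda>\<omega>. f (A (Suc n) k \<omega>)) \<in> borel_measurable (sigma_of M {A (Suc n) k | k. k \<in> {1..d}})"
    by (rule measurable_compose[OF measurable_sigma_of]) (use k in auto)
  have [measurable]: "X (Suc n) k \<in> measurable (GX n) (count_space UNIV)"
    by (rule measurable_sigma_of) (use k in auto)
  have [measurable]: "g \<in> borel_measurable (GX n)" by (rule measurable_G_GX[OF g(1)])
  have gX: "(\<lambda>\<omega>. g \<omega> * real (X (Suc n) k \<omega>)) \<in> borel_measurable (GX n)" by measurable
  note ind = indep_set_expectation_mult[OF A_indep subalgebras(4) subalgebras(3) fA f gX expectation_draw(1)[OF k g]]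
  have eq: "f (A (Suc n) k \<omega>) * (g \<omega> * real (X (Suc n) k \<omega>)) = g \<omega> * (f (A (Suc n) k \<omega>) * real (X (Suc n) k \<omega>))" for \<omega>
    by simp
  show "integrable M (\<lambda>\<omega>. g \<omega> * (f (A (Suc n) k \<omega>) * real (X (Suc n) k \<omega>)))"
    using ind(1) unfolding eq .
  show "expectation (\<lambda>\<omega>. g \<omega> * (f (A (Suc n) k \<omega>) * real (X (Suc n) k \<omega>)))
      = expectation (\<lambda>\<omega>. f (A (Suc n) k \<omega>)) * expectation (\<lambda>\<omega>. g \<omega> * (real (N (Suc n) \<omega>) * share n k \<omega>))"
    using ind(2) unfolding eq expectation_draw(2)[OF k g] .
qed

end

section \<open>The potential of a dominant color\<close>

text \<open>
  Here \<open>h\<close> balls of a color and \<open>s\<close> balls altogether increase by \<open>y\<close> and \<open>D\<close>, after \<open>x\<close> balls of that color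
  have been drawn. The last summand comes from the decrease of \<open>K / h\<close>, bounded below linearly in \<open>x\<close>.
\<close>
lemma log_ratio_increment_le:
  fixes h s y x c D K :: real
  assumes h: "h \<ge> 1" and s: "s > 0" and D: "D \<ge> 0" and x: "0 \<le> x" "x \<le> c" and c: "c > 0" and K: "K \<ge> 0"
    and y: "0 \<le> y" "x > 0 \<Longrightarrow> 1 \<le> y"
  shows "(ln (s + D) - ln (h + y) + K / (h + y)) - (ln s - ln h + K / h)
    \<le> D / s - y / h + (y / h)\<^sup>2 - K / (2 * c) * (x / h\<^sup>2)"
proof -
  have "ln (s + D) - ln s = ln (1 + D / s)"
    using s D ln_mult_pos[of s "1 + D / s"] by (simp add: distrib_left add_pos_nonneg)
  also have "\<dots> \<le> D / s" using s D by (intro ln_add_one_self_le_self) auto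
  finally have 1: "ln (s + D) - ln s \<le> D / s" .
  define z where "z = y / h"
  have z: "z \<ge> 0" unfolding z_def using h y by simp
  have "z - z\<^sup>2 \<le> ln (1 + z)"
  proof (cases "z \<le> 1")
    case True
    then show ?thesis using ln_one_plus_pos_lower_bound z by simp
  next
    case False
    then have "z - z\<^sup>2 \<le> 0" by (simp add: power2_eq_square)
    also have "0 \<le> ln (1 + z)" using z by simp
    finally show ?thesis .
  qed
  also have "ln (1 + z) = ln (h + y) - ln h"
    using h z ln_mult_pos[of h "1 + z"] y by (simp add: z_def distrib_left add_pos_nonneg)
  finally have 2: "y / h - (y / h)\<^sup>2 \<le> ln (h + y) - ln h" unfolding z_def .
  have 3: "K / (2 * c) * (x / h\<^sup>2) \<le> K / h - K / (h + y)"
  proof (cases "x > 0")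
    case True
    have "K / (2 * c) * (x / h\<^sup>2) = (x / c) * (K / (2 * h\<^sup>2))" by (simp add: mult_ac)
    also have "\<dots> \<le> 1 * (K / (2 * h\<^sup>2))"
      using x c K by (intro mult_right_mono) auto
    also have "1 * (K / (2 * h\<^sup>2)) \<le> K / (h * (h + 1))"
      unfolding mult_1
    proof (intro divide_left_mono K)
      show "h * (h + 1) \<le> 2 * h\<^sup>2" using h by (simp add: power2_eq_square algebra_simps)
      show "0 < 2 * h\<^sup>2 * (h * (h + 1))" using h by (intro mult_pos_pos) auto
    qed
    also have "\<dots> = K / h - K / (h + 1)" using h by (simp add: field_simps)
    also have "\<dots> \<le> K / h - K / (h + y)"
      using h K y(2)[OF True] by (intro diff_mono divide_left_mono) auto
    finally show ?thesis .
  next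
    case False
    then have "K / (2 * c) * (x / h\<^sup>2) = 0" using x by simp
    also have "\<dots> \<le> K / h - K / (h + y)"
      using h K y(1) by (simp add: divide_left_mono)
    finally show ?thesis .
  qed
  from 1 2 3 show ?thesis by linarith
qed

text \<open>
  The urn with the moment assumptions that the argument needs: second moments bounded by \<open>B\<close>,
  converging means, equal means for the dominant colors \<open>{1..t}\<close> at every stage, and a strictly smaller limit
  for each minor color.
\<close>
locale dominated_urn = randomly_reinforced_urn M d C1 H0 N X A
  for M :: "'a measure" and d C1 H0 N X A +
  fixes t :: nat and m :: "nat \<Rightarrow> real" and B :: real
  assumes A_sq_int: "\<And>n k. k \<in> {1..d} \<Longrightarrow> integrable M (\<lambda>\<omega>. (real (A (Suc n) k \<omega>))\<^sup>2)"
    and A_sq_le: "\<And>n k. k \<in> {1..d} \<Longrightarrow> expectation (\<lambda>\<omega>. (real (A (Suc n) k \<omega>))\<^sup>2) \<le> B"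
    and mean_tendsto: "\<And>k. k \<in> {1..d} \<Longrightarrow> (\<lambda>n. expectation (\<lambda>\<omega>. real (A (Suc n) k \<omega>))) \<longlonglongrightarrow> m k"
    and t: "t \<in> {1..d}"
    and mean_equal: "\<And>n k. k \<in> {1..t} \<Longrightarrow>
      expectation (\<lambda>\<omega>. real (A (Suc n) k \<omega>)) = expectation (\<lambda>\<omega>. real (A (Suc n) 1 \<omega>))"
    and gap: "\<And>k. k \<in> {t+1..d} \<Longrightarrow> m k < m 1"
begin

abbreviation "mean n k \<equiv> expectation (\<lambda>\<omega>. real (A (Suc n) k \<omega>))"

text \<open>The replacements are natural numbers and therefore bounded by their squares.\<close>
lemma A_int: "k \<in> {1..d} \<Longrightarrow> integrable M (\<lambda>\<omega>. real (A (Suc n) k \<omega>))"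
  using A_measurable[of "Suc n" k]
  by (intro Bochner_Integration.integrable_bound[OF A_sq_int[of k n]])
    (auto intro!: AE_I2 simp: power2_eq_square simp flip: of_nat_mult)

lemma mean_bounds: assumes "k \<in> {1..d}" shows "0 \<le> mean n k" "mean n k \<le> B"
proof -
  have "mean n k \<le> expectation (\<lambda>\<omega>. (real (A (Suc n) k \<omega>))\<^sup>2)"
    using assms by (intro integral_mono A_int A_sq_int) (auto simp: power2_eq_square simp flip: of_nat_mult)
  then show "mean n k \<le> B" using A_sq_le[OF assms, of n] by linarith
qed (simp add: integral_nonneg_AE)

lemma B_nonneg: "0 \<le> B"
  using order.trans[OF mean_bounds[of 1 0]] d_ge_2 by simp

text \<open>
  The logarithm of \<open>1 / Z n k\<close>, corrected by \<open>K / H n k\<close>. With \<open>K = 2 C1\<^sup>2 B\<close> the mean decrease of the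
  correction is at least the second-order error in the growth of \<open>ln (H n k)\<close>.
\<close>
definition potential :: "nat \<Rightarrow> nat \<Rightarrow> 'a \<Rightarrow> real" where
  "potential k n \<omega> = ln (contents n \<omega>) - ln (balls n k \<omega>) + 2 * (real C1)\<^sup>2 * B / balls n k \<omega>"

lemma potential_adapted: "k \<in> {1..d} \<Longrightarrow> potential k n \<in> borel_measurable (F n)"
  using balls_F_measurable contents_F_measurable unfolding potential_def by measurable

lemma potential_nonneg: assumes "k \<in> {1..d}" shows "0 \<le> potential k n \<omega>"
proof -
  have "ln (balls n k \<omega>) \<le> ln (contents n \<omega>)"
    using balls_le_contents[OF assms, of n \<omega>] balls_ge_1[OF assms, of n \<omega>] by simp
  moreover have "0 \<le> 2 * (real C1)\<^sup>2 * B / balls n k \<omega>" using B_nonneg by simp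
  ultimately show ?thesis unfolding potential_def by linarith
qed

lemma AX_int:
  assumes "k \<in> {1..d}" shows "integrable M (\<lambda>\<omega>. real (A (Suc n) k \<omega>) * real (X (Suc n) k \<omega>))"
proof -
  have "(\<lambda>_. 1 :: real) \<in> borel_measurable (G n)" "integrable M (\<lambda>_. 1 :: real)" by auto
  from expectation_reinforcement(1)[OF assms this A_int[OF assms]] show ?thesis by (simp only: mult_1)
qed

lemma contents_int: "integrable M (\<lambda>\<omega>. contents n \<omega>)"
proof (induction n)
  case 0
  then show ?case by (simp add: urn_S_def urn_H_def)
next
  case (Suc n)
  then show ?case unfolding contents_Suc by (intro Bochner_Integration.integrable_add Bochner_Integration.integrable_sum AX_int)
qed

lemma potential_int: assumes "k \<in> {1..d}" shows "integrable M (potential k n)"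
proof (rule Bochner_Integration.integrable_bound)
  show "integrable M (\<lambda>\<omega>. contents n \<omega> + 2 * (real C1)\<^sup>2 * B)" using contents_int by simp
  show "potential k n \<in> borel_measurable M" by (rule measurable_F_M[OF potential_adapted[OF assms]])
  show "AE \<omega> in M. norm (potential k n \<omega>) \<le> norm (contents n \<omega> + 2 * (real C1)\<^sup>2 * B)"
  proof (intro AE_I2)
    fix \<omega>
    have "ln (contents n \<omega>) \<le> contents n \<omega>" using contents_ge_1[of n \<omega>] ln_le_minus_one[of "contents n \<omega>"] by linarith
    moreover have "0 \<le> ln (balls n k \<omega>)" using balls_ge_1[OF assms, of n \<omega>] by simp
    moreover have "2 * (real C1)\<^sup>2 * B / balls n k \<omega> \<le> 2 * (real C1)\<^sup>2 * B / 1"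
      using balls_ge_1[OF assms, of n \<omega>] B_nonneg by (intro divide_left_mono) auto
    ultimately show "norm (potential k n \<omega>) \<le> norm (contents n \<omega> + 2 * (real C1)\<^sup>2 * B)"
      using potential_nonneg[OF assms, of n \<omega>] unfolding potential_def by simp
  qed
qed

text \<open>The joint share of the minor colors; it is \<open>0\<close> if \<open>t = d\<close>.\<close>
definition minor_share :: "nat \<Rightarrow> 'a \<Rightarrow> real" where
  "minor_share n \<omega> = (\<Sum>j\<in>{t+1..d}. share n j \<omega>)"

lemma minor_share_bounds: "0 \<le> minor_share n \<omega>" "minor_share n \<omega> \<le> 1"
proof -
  show "0 \<le> minor_share n \<omega>" unfolding minor_share_def using t by (intro sum_nonneg share_bounds) auto
  have "minor_share n \<omega> \<le> (\<Sum>j=1..d. share n j \<omega>)"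
    unfolding minor_share_def using t by (intro sum_mono2 share_bounds) auto
  then show "minor_share n \<omega> \<le> 1" using sum_share[of n \<omega>] by simp
qed

lemma minor_share_adapted: "minor_share n \<in> borel_measurable (F n)"
  unfolding minor_share_def using t by (intro borel_measurable_sum share_F_measurable) auto

text \<open>
  The weight \<open>g\<close> stands for conditioning on \<open>F n\<close>. The constant \<open>\<delta>\<close> is a lower bound for the gap between the mean of the
  dominant colors and those of the minor ones at stage \<open>n + 1\<close>.
\<close>
lemma potential_drift:
  assumes k: "k \<in> {1..t}" and \<delta>: "\<delta> \<ge> 0" "\<And>j. j \<in> {t+1..d} \<Longrightarrow> mean n j + \<delta> \<le> mean n 1"
    and g: "g \<in> borel_measurable (F n)" "\<And>\<omega>. \<omega> \<in> space M \<Longrightarrow> 0 \<le> g \<omega> \<and> g \<omega> \<le> 1"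
  shows "expectation (\<lambda>\<omega>. g \<omega> * (potential k (Suc n) \<omega> - potential k n \<omega>))
    \<le> - \<delta> * expectation (\<lambda>\<omega>. g \<omega> * (minor_share n \<omega> / contents n \<omega>))"
proof -
  have kd: "k \<in> {1..d}" using k t by auto
  have C1: "real C1 > 0" using C1_pos by simp
  define a where "a j \<omega> = real (A (Suc n) j \<omega>)" for j \<omega>
  define x where "x j \<omega> = real (X (Suc n) j \<omega>)" for j \<omega>
  define v where "v \<omega> = real (N (Suc n) \<omega>)" for \<omega>
  define h where "h \<omega> = balls n k \<omega>" for \<omega>
  define s where "s \<omega> = contents n \<omega>" for \<omega>
  define q where "q \<omega> = g \<omega> / s \<omega>" for \<omega>
  define u where "u \<omega> = g \<omega> / h \<omega>" for \<omega>
  define r where "r \<omega> = g \<omega> / (h \<omega>)\<^sup>2" for \<omega>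
  have h1: "h \<omega> \<ge> 1" for \<omega> unfolding h_def by (rule balls_ge_1[OF kd])
  have s1: "s \<omega> \<ge> 1" for \<omega> unfolding s_def by (rule contents_ge_1)
  have [measurable]: "h \<in> borel_measurable (F n)" "s \<in> borel_measurable (F n)"
    unfolding h_def s_def using balls_F_measurable[OF kd] contents_F_measurable by auto
  note g(1) [measurable]
  have qur_F: "q \<in> borel_measurable (F n)" "u \<in> borel_measurable (F n)" "r \<in> borel_measurable (F n)"
    unfolding q_def u_def r_def by measurable
  note qur_G = qur_F[THEN measurable_F_G]
  note qur_M [measurable] = qur_F[THEN measurable_F_M]
  have qur_bounds: "0 \<le> q \<omega> \<and> q \<omega> \<le> 1" "0 \<le> u \<omega> \<and> u \<omega> \<le> 1" "0 \<le> r \<omega> \<and> r \<omega> \<le> 1" if "\<omega> \<in> space M" for \<omega>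
  proof -
    have "g \<omega> / y \<le> 1 \<and> 0 \<le> g \<omega> / y" if "y \<ge> 1" for y
      using g(2)[OF \<open>\<omega> \<in> space M\<close>] that by (simp add: divide_le_eq_1)
    moreover have "(h \<omega>)\<^sup>2 \<ge> 1" using h1[of \<omega>] by simp
    ultimately show "0 \<le> q \<omega> \<and> q \<omega> \<le> 1" "0 \<le> u \<omega> \<and> u \<omega> \<le> 1" "0 \<le> r \<omega> \<and> r \<omega> \<le> 1"
      unfolding q_def u_def r_def using h1[of \<omega>] s1[of \<omega>] by auto
  qed
  have qur_int: "integrable M q" "integrable M u" "integrable M r"
    by (rule integrable_const_bound[where B = 1], use qur_bounds in \<open>auto intro!: AE_I2\<close>)+
  have [measurable]: "v \<in> borel_measurable M" unfolding v_def using N_measurable[of "Suc n"] by measurable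
  have share_M [measurable]: "(\<lambda>\<omega>. share n j \<omega>) \<in> borel_measurable M" if "j \<in> {1..d}" for j
    by (rule measurable_F_M[OF share_F_measurable[OF that]])
  have v: "1 \<le> v \<omega>" "v \<omega> \<le> C1" if "\<omega> \<in> space M" for \<omega>
    unfolding v_def by (rule draw_count_bounds[OF that])+
  have bounded_int: "integrable M f"
    if "f \<in> borel_measurable M" "\<And>\<omega>. \<omega> \<in> space M \<Longrightarrow> 0 \<le> f \<omega> \<and> f \<omega> \<le> C1" for f :: "'a \<Rightarrow> real"
    by (rule integrable_const_bound[where B = C1]) (use that in \<open>auto intro!: AE_I2\<close>)
  have qv_bounds: "0 \<le> q \<omega> * (v \<omega> * share n j \<omega>) \<and> q \<omega> * (v \<omega> * share n j \<omega>) \<le> C1"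
    "0 \<le> q \<omega> * share n j \<omega> \<and> q \<omega> * share n j \<omega> \<le> q \<omega> * (v \<omega> * share n j \<omega>)"
    if "\<omega> \<in> space M" "j \<in> {1..d}" for j \<omega>
  proof -
    note b = qur_bounds(1)[OF that(1)] v[OF that(1)] share_bounds[OF that(2), of n \<omega>]
    have "v \<omega> * share n j \<omega> \<le> real C1 * 1" using b by (intro mult_mono) auto
    then have "q \<omega> * (v \<omega> * share n j \<omega>) \<le> 1 * (real C1 * 1)" using b by (intro mult_mono) auto
    then show "0 \<le> q \<omega> * (v \<omega> * share n j \<omega>) \<and> q \<omega> * (v \<omega> * share n j \<omega>) \<le> C1" using b by simp
    have "1 * share n j \<omega> \<le> v \<omega> * share n j \<omega>" using b by (intro mult_right_mono) auto
    then show "0 \<le> q \<omega> * share n j \<omega> \<and> q \<omega> * share n j \<omega> \<le> q \<omega> * (v \<omega> * share n j \<omega>)"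
      using b by (auto intro!: mult_left_mono)
  qed
  define e where "e j = expectation (\<lambda>\<omega>. q \<omega> * (v \<omega> * share n j \<omega>))" for j
  have qv_int: "integrable M (\<lambda>\<omega>. q \<omega> * (v \<omega> * share n j \<omega>))" if "j \<in> {1..d}" for j
    using qv_bounds(1)[OF _ that] that by (intro bounded_int) auto
  have qs_int: "integrable M (\<lambda>\<omega>. q \<omega> * share n j \<omega>)" if "j \<in> {1..d}" for j
    using qv_bounds[OF _ that] that by (intro bounded_int) (auto intro: order.trans)
  have sq_fun: "integrable M (\<lambda>\<omega>. (\<lambda>i. (real i)\<^sup>2) (A (Suc n) k \<omega>))" using A_sq_int[OF kd] by simp
  note reinf_q = expectation_reinforcement[OF _ qur_G(1) qur_int(1) A_int, folded a_def x_def v_def]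
  note reinf_u = expectation_reinforcement[OF kd qur_G(2) qur_int(2) A_int[OF kd], folded a_def x_def v_def]
  note reinf_r = expectation_reinforcement[OF kd qur_G(3) qur_int(3) sq_fun, folded a_def x_def v_def]
  note draw_r = expectation_draw[OF kd qur_G(3) qur_int(3), folded x_def v_def]
  have mean_a: "mean n j = expectation (a j)" for j unfolding a_def ..
  \<comment> \<open>An upper bound for the weighted increment that is linear in the drawn vector.\<close>
  define R where "R \<omega> = (\<Sum>j=1..d. q \<omega> * (a j \<omega> * x j \<omega>)) - u \<omega> * (a k \<omega> * x k \<omega>)
    + C1 * (r \<omega> * ((a k \<omega>)\<^sup>2 * x k \<omega>)) - C1 * B * (r \<omega> * x k \<omega>)" for \<omega>
  have q_int: "integrable M (\<lambda>\<omega>. \<Sum>j=1..d. q \<omega> * (a j \<omega> * x j \<omega>))"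
    by (intro Bochner_Integration.integrable_sum reinf_q(1))
  note R_parts = q_int reinf_u(1) integrable_mult_right[OF reinf_r(1), of "real C1"]
    integrable_mult_right[OF draw_r(1), of "C1 * B"]
  note R_sub = Bochner_Integration.integrable_diff[OF R_parts(1,2)]
  note R_add = Bochner_Integration.integrable_add[OF R_sub R_parts(3)]
  have R_int: "integrable M R" unfolding R_def
    by (rule Bochner_Integration.integrable_diff[OF R_add R_parts(4)])
  have pathwise: "g \<omega> * (potential k (Suc n) \<omega> - potential k n \<omega>) \<le> R \<omega>" if w: "\<omega> \<in> space M" for \<omega>
  proof -
    have a1: "a k \<omega> \<ge> 1" unfolding a_def using A_ge_1[OF kd w, of n] by simp
    have x0: "0 \<le> x k \<omega>" "x k \<omega> \<le> C1" unfolding x_def using draw_le(2)[OF w kd, of n] by auto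
    have "potential k (Suc n) \<omega> - potential k n \<omega>
        \<le> (\<Sum>j=1..d. a j \<omega> * x j \<omega>) / s \<omega> - (a k \<omega> * x k \<omega>) / h \<omega> + ((a k \<omega> * x k \<omega>) / h \<omega>)\<^sup>2
          - (2 * (real C1)\<^sup>2 * B) / (2 * real C1) * (x k \<omega> / (h \<omega>)\<^sup>2)"
      unfolding potential_def balls_Suc contents_Suc
      unfolding a_def[symmetric] x_def[symmetric] h_def[symmetric] s_def[symmetric]
    proof (rule log_ratio_increment_le)
      show "0 \<le> (\<Sum>j=1..d. a j \<omega> * x j \<omega>)" unfolding a_def x_def by (intro sum_nonneg) simp
      show "1 \<le> a k \<omega> * x k \<omega>" if "x k \<omega> > 0"
      proof -
        have "x k \<omega> \<ge> 1" using that unfolding x_def by simp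
        then show ?thesis using a1 mult_mono[of 1 "a k \<omega>" 1 "x k \<omega>"] by simp
      qed
    qed (use h1[of \<omega>] s1[of \<omega>] x0 a1 C1 B_nonneg in auto)
    also have "(2 * (real C1)\<^sup>2 * B) / (2 * real C1) = C1 * B" using C1 by (simp add: power2_eq_square)
    also have "((a k \<omega> * x k \<omega>) / h \<omega>)\<^sup>2 \<le> C1 * ((a k \<omega>)\<^sup>2 * x k \<omega>) / (h \<omega>)\<^sup>2"
    proof -
      have "(a k \<omega>)\<^sup>2 * x k \<omega> * x k \<omega> \<le> (a k \<omega>)\<^sup>2 * x k \<omega> * C1" using x0 by (intro mult_left_mono) auto
      then have "(a k \<omega> * x k \<omega>)\<^sup>2 \<le> C1 * ((a k \<omega>)\<^sup>2 * x k \<omega>)" by (simp add: power2_eq_square mult_ac)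
      then show ?thesis unfolding power_divide by (rule divide_right_mono) simp
    qed
    finally have "potential k (Suc n) \<omega> - potential k n \<omega>
        \<le> (\<Sum>j=1..d. a j \<omega> * x j \<omega>) / s \<omega> - (a k \<omega> * x k \<omega>) / h \<omega> + C1 * ((a k \<omega>)\<^sup>2 * x k \<omega>) / (h \<omega>)\<^sup>2
          - C1 * B * (x k \<omega> / (h \<omega>)\<^sup>2)" by simp
    from mult_left_mono[OF this, of "g \<omega>"] g(2)[OF w]
    have "g \<omega> * (potential k (Suc n) \<omega> - potential k n \<omega>)
      \<le> g \<omega> * ((\<Sum>j=1..d. a j \<omega> * x j \<omega>) / s \<omega> - (a k \<omega> * x k \<omega>) / h \<omega> + C1 * ((a k \<omega>)\<^sup>2 * x k \<omega>) / (h \<omega>)\<^sup>2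
          - C1 * B * (x k \<omega> / (h \<omega>)\<^sup>2))" by simp
    also have "\<dots> = R \<omega>"
      unfolding R_def q_def u_def r_def sum_distrib_left[symmetric]
      by (simp add: right_diff_distrib distrib_left mult_ac)
    finally show ?thesis .
  qed
  have pot_int: "integrable M (\<lambda>\<omega>. g \<omega> * (potential k (Suc n) \<omega> - potential k n \<omega>))"
  proof (rule Bochner_Integration.integrable_bound)
    show "integrable M (\<lambda>\<omega>. potential k (Suc n) \<omega> - potential k n \<omega>)" using potential_int[OF kd] by simp
    show "(\<lambda>\<omega>. g \<omega> * (potential k (Suc n) \<omega> - potential k n \<omega>)) \<in> borel_measurable M"
      using measurable_F_M[OF g(1)] potential_int[OF kd] by measurable
    show "AE \<omega> in M. norm (g \<omega> * (potential k (Suc n) \<omega> - potential k n \<omega>))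
        \<le> norm (potential k (Suc n) \<omega> - potential k n \<omega>)"
      using g(2) by (intro AE_I2) (auto simp: abs_mult intro!: mult_left_le_one_le)
  qed
  define EU where "EU = expectation (\<lambda>\<omega>. u \<omega> * (v \<omega> * share n k \<omega>))"
  define T where "T = expectation (\<lambda>\<omega>. r \<omega> * (v \<omega> * share n k \<omega>))"
  define P where "P = (\<Sum>j=1..d. mean n j * e j)"
  have le_R: "expectation (\<lambda>\<omega>. g \<omega> * (potential k (Suc n) \<omega> - potential k n \<omega>)) \<le> expectation R"
    by (intro integral_mono pot_int R_int pathwise)
  have R_eq: "expectation R = P - mean n k * EU + C1 * (expectation (\<lambda>\<omega>. (a k \<omega>)\<^sup>2) * T) - C1 * B * T"
  proof -
    have "expectation R = expectation (\<lambda>\<omega>. \<Sum>j=1..d. q \<omega> * (a j \<omega> * x j \<omega>))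
        - expectation (\<lambda>\<omega>. u \<omega> * (a k \<omega> * x k \<omega>))
        + C1 * expectation (\<lambda>\<omega>. r \<omega> * ((a k \<omega>)\<^sup>2 * x k \<omega>))
        - C1 * B * expectation (\<lambda>\<omega>. r \<omega> * x k \<omega>)"
      unfolding R_def
      by (simp only: Bochner_Integration.integral_diff[OF R_add R_parts(4)]
          Bochner_Integration.integral_add[OF R_sub R_parts(3)]
          Bochner_Integration.integral_diff[OF R_parts(1,2)] integral_mult_right_zero)
    moreover have "expectation (\<lambda>\<omega>. \<Sum>j=1..d. q \<omega> * (a j \<omega> * x j \<omega>)) = P"
      unfolding P_def by (subst Bochner_Integration.integral_sum)
        (auto intro!: sum.cong reinf_q simp: e_def mean_a)
    ultimately show ?thesis
      unfolding reinf_u(2) reinf_r(2) draw_r(2) EU_def[symmetric] T_def[symmetric] mean_a by simp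
  qed
  \<comment> \<open>The correction term of the potential absorbs the second-order error.\<close>
  have cancel: "C1 * (expectation (\<lambda>\<omega>. (a k \<omega>)\<^sup>2) * T) \<le> C1 * B * T"
  proof -
    have "T \<ge> 0" unfolding T_def
      using qur_bounds(3) v share_bounds[OF kd] by (intro integral_nonneg_AE AE_I2) (auto simp: v_def)
    then have "expectation (\<lambda>\<omega>. (a k \<omega>)\<^sup>2) * T \<le> B * T"
      using A_sq_le[OF kd, of n] unfolding a_def by (intro mult_right_mono)
    then have "C1 * (expectation (\<lambda>\<omega>. (a k \<omega>)\<^sup>2) * T) \<le> C1 * (B * T)"
      using C1 by (intro mult_left_mono) auto
    then show ?thesis by (simp add: mult.assoc)
  qed
  have EU: "EU = (\<Sum>j=1..d. e j)"
  proof -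
    have "u \<omega> * (v \<omega> * share n k \<omega>) = (\<Sum>j=1..d. q \<omega> * (v \<omega> * share n j \<omega>))" for \<omega>
    proof -
      have "u \<omega> * share n k \<omega> = q \<omega>"
        unfolding u_def q_def urn_Z_def h_def[symmetric] s_def[symmetric] using h1[of \<omega>] by simp
      then show ?thesis unfolding sum_distrib_left[symmetric] sum_share by (simp add: mult_ac)
    qed
    then show ?thesis unfolding EU_def e_def using qv_int by simp
  qed
  have "P - mean n k * EU = (\<Sum>j=1..d. (mean n j - mean n 1) * e j)"
    unfolding P_def EU mean_equal[OF k, of n]
    by (simp only: sum_distrib_left sum_subtractf left_diff_distrib)
  also have "\<dots> = (\<Sum>j\<in>{t+1..d}. (mean n j - mean n 1) * e j)"
  proof (intro sum.mono_neutral_right ballI)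
    fix j assume "j \<in> {1..d} - {t+1..d}"
    then have "j \<in> {1..t}" by auto
    then show "(mean n j - mean n 1) * e j = 0" by (simp only: mean_equal) simp
  qed auto
  also have "\<dots> \<le> (\<Sum>j\<in>{t+1..d}. - \<delta> * expectation (\<lambda>\<omega>. q \<omega> * share n j \<omega>))"
  proof (rule sum_mono)
    fix j assume j: "j \<in> {t+1..d}"
    then have jd: "j \<in> {1..d}" by simp
    have le: "expectation (\<lambda>\<omega>. q \<omega> * share n j \<omega>) \<le> e j"
      unfolding e_def using qv_bounds(2)[OF _ jd] by (intro integral_mono qs_int qv_int jd) auto
    have "0 \<le> expectation (\<lambda>\<omega>. q \<omega> * share n j \<omega>)"
      using qv_bounds(2)[OF _ jd] by (intro integral_nonneg_AE AE_I2) auto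
    then have "0 \<le> e j" using le by linarith
    then have "(mean n j - mean n 1) * e j \<le> - \<delta> * e j"
      using \<delta>(2)[OF j] by (intro mult_right_mono) auto
    also have "\<dots> \<le> - \<delta> * expectation (\<lambda>\<omega>. q \<omega> * share n j \<omega>)"
      using le \<delta>(1) by (simp add: mult_left_mono)
    finally show "(mean n j - mean n 1) * e j \<le> - \<delta> * expectation (\<lambda>\<omega>. q \<omega> * share n j \<omega>)" .
  qed
  finally have "P - mean n k * EU \<le> (\<Sum>j\<in>{t+1..d}. - \<delta> * expectation (\<lambda>\<omega>. q \<omega> * share n j \<omega>))" .
  moreover have "(\<Sum>j\<in>{t+1..d}. - \<delta> * expectation (\<lambda>\<omega>. q \<omega> * share n j \<omega>))
      = - \<delta> * expectation (\<lambda>\<omega>. g \<omega> * (minor_share n \<omega> / contents n \<omega>))"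
  proof -
    have "g \<omega> * (minor_share n \<omega> / contents n \<omega>) = (\<Sum>j\<in>{t+1..d}. q \<omega> * share n j \<omega>)" for \<omega>
      unfolding minor_share_def q_def s_def by (simp add: sum_distrib_left sum_divide_distrib)
    then have "expectation (\<lambda>\<omega>. g \<omega> * (minor_share n \<omega> / contents n \<omega>))
        = expectation (\<lambda>\<omega>. \<Sum>j\<in>{t+1..d}. q \<omega> * share n j \<omega>)" by presburger
    also have "\<dots> = (\<Sum>j\<in>{t+1..d}. expectation (\<lambda>\<omega>. q \<omega> * share n j \<omega>))"
      by (intro Bochner_Integration.integral_sum qs_int) auto
    finally show ?thesis by (simp only: sum_distrib_left)
  qed
  ultimately show ?thesis using le_R R_eq cancel by linarith
qed

section \<open>Convergence of the shares\<close>

lemma mean_gap: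
  obtains \<delta> n0 where "\<delta> > 0" "\<And>n j. n \<ge> n0 \<Longrightarrow> j \<in> {t+1..d} \<Longrightarrow> mean n j + \<delta> \<le> mean n 1"
proof -
  define \<delta> where "\<delta> = Min (insert 1 ((\<lambda>j. (m 1 - m j) / 2) ` {t+1..d}))"
  have "\<delta> > 0" unfolding \<delta>_def using gap by (subst Min_gr_iff) auto
  have le: "\<delta> \<le> (m 1 - m j) / 2" if "j \<in> {t+1..d}" for j
    unfolding \<delta>_def using that by (intro Min_le) auto
  have "\<forall>\<^sub>F n in sequentially. \<forall>j\<in>{t+1..d}. mean n j + \<delta> \<le> mean n 1"
  proof (rule eventually_ball_finite, simp, rule ballI)
    fix j assume j: "j \<in> {t+1..d}"
    have "(\<lambda>n. mean n 1 - mean n j) \<longlonglongrightarrow> m 1 - m j"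
      using j d_ge_2 by (intro tendsto_diff mean_tendsto) auto
    then have "\<forall>\<^sub>F n in sequentially. (m 1 - m j) / 2 < mean n 1 - mean n j"
      using gap[OF j] by (intro order_tendstoD) auto
    then show "\<forall>\<^sub>F n in sequentially. mean n j + \<delta> \<le> mean n 1"
      by eventually_elim (use le[OF j] in linarith)
  qed
  then show ?thesis using that \<open>\<delta> > 0\<close> unfolding eventually_sequentially by blast
qed

text \<open>The drift is only controlled from stage \<open>n0\<close> on, so the supermartingale theorem is applied to the shifted filtration.\<close>
lemma share_AE_convergent:
  assumes k: "k \<in> {1..t}"
  shows "AE \<omega> in M. convergent (\<lambda>n. share n k \<omega>)"
proof -
  have kd: "k \<in> {1..d}" using k t by auto
  obtain \<delta> n0 where \<delta>: "\<delta> > 0" "\<And>n j. n \<ge> n0 \<Longrightarrow> j \<in> {t+1..d} \<Longrightarrow> mean n j + \<delta> \<le> mean n 1"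
    by (rule mean_gap) blast
  interpret shifted: discrete_filtration M "\<lambda>n. F (n + n0)"
    by unfold_locales (use subalg step in auto)
  have "AE \<omega> in M. convergent (\<lambda>n. exp (- potential k (n + n0) \<omega>))"
  proof (rule shifted.exp_minus_supermartingale_AE_convergent)
    fix n and g :: "'a \<Rightarrow> real"
    assume g: "g \<in> borel_measurable (F (n + n0))" "\<And>\<omega>. \<omega> \<in> space M \<Longrightarrow> 0 \<le> g \<omega> \<and> g \<omega> \<le> 1"
    have "expectation (\<lambda>\<omega>. g \<omega> * (potential k (Suc (n + n0)) \<omega> - potential k (n + n0) \<omega>))
        \<le> - \<delta> * expectation (\<lambda>\<omega>. g \<omega> * (minor_share (n + n0) \<omega> / contents (n + n0) \<omega>))"
      by (rule potential_drift[OF k _ _ g]) (use \<delta> in auto)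
    also have "\<dots> \<le> 0"
    proof -
      have "0 \<le> expectation (\<lambda>\<omega>. g \<omega> * (minor_share (n + n0) \<omega> / contents (n + n0) \<omega>))"
        using g(2) minor_share_bounds(1) by (intro integral_nonneg_AE AE_I2) simp
      then show ?thesis using \<delta>(1) mult_nonneg_nonneg[OF less_imp_le] by simp
    qed
    finally show "expectation (\<lambda>\<omega>. g \<omega> * (potential k (Suc n + n0) \<omega> - potential k (n + n0) \<omega>)) \<le> 0"
      by simp
  qed (use potential_adapted potential_nonneg potential_int kd in auto)
  then show ?thesis
  proof (rule AE_mp, intro AE_I2 impI)
    fix \<omega> assume "convergent (\<lambda>n. exp (- potential k (n + n0) \<omega>))"
    then have conv: "convergent (\<lambda>n. exp (- potential k n \<omega>))" by (subst (asm) convergent_ignore_initial_segment)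
    define K where "K = 2 * (real C1)\<^sup>2 * B"
    have K: "K \<ge> 0" unfolding K_def using B_nonneg by simp
    have pos: "balls n k \<omega> \<ge> 1" for n by (rule balls_ge_1[OF kd])
    have "decseq (\<lambda>n. K / balls n k \<omega>)"
    proof (rule decseq_SucI)
      fix n
      have "balls n k \<omega> \<le> balls (Suc n) k \<omega>" unfolding balls_Suc by simp
      then show "K / balls (Suc n) k \<omega> \<le> K / balls n k \<omega>"
        using pos[of n] K by (intro divide_left_mono) auto
    qed
    then obtain L where "(\<lambda>n. K / balls n k \<omega>) \<longlonglongrightarrow> L"
      using decseq_convergent[of "\<lambda>n. K / balls n k \<omega>" 0] K by auto
    then have "convergent (\<lambda>n. exp (K / balls n k \<omega>))" by (auto intro: convergentI tendsto_exp)
    with conv have "convergent (\<lambda>n. exp (- potential k n \<omega>) * exp (K / balls n k \<omega>))"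
      by (rule convergent_mult)
    moreover have "exp (- potential k n \<omega>) * exp (K / balls n k \<omega>) = share n k \<omega>" for n
    proof -
      have "exp (- potential k n \<omega>) * exp (K / balls n k \<omega>) = exp (ln (balls n k \<omega>) - ln (contents n \<omega>))"
        unfolding potential_def K_def exp_add[symmetric] by simp
      also have "\<dots> = share n k \<omega>"
        unfolding urn_Z_def exp_diff using pos[of n] contents_ge_1[of n \<omega>] by simp
      finally show ?thesis .
    qed
    ultimately show "convergent (\<lambda>n. share n k \<omega>)" by simp
  qed
qed

lemma minor_share_quotient_AE_summable:
  "AE \<omega> in M. summable (\<lambda>n. minor_share n \<omega> / contents n \<omega>)"
proof -
  have 1: "1 \<in> {1..t}" "1 \<in> {1..d}" using t by auto
  obtain \<delta> n0 where \<delta>: "\<delta> > 0" "\<And>n j. n \<ge> n0 \<Longrightarrow> j \<in> {t+1..d} \<Longrightarrow> mean n j + \<delta> \<le> mean n 1"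
    by (rule mean_gap) blast
  define q where "q n \<omega> = minor_share (n + n0) \<omega> / contents (n + n0) \<omega>" for n \<omega>
  have q_bounds: "0 \<le> q n \<omega>" "q n \<omega> \<le> 1" for n \<omega>
    using minor_share_bounds[of "n + n0" \<omega>] contents_ge_1[of "n + n0" \<omega>]
    unfolding q_def by (auto simp: divide_le_eq_1)
  have q_int: "integrable M (q n)" for n
  proof (rule integrable_const_bound[where B = 1])
    have [measurable]: "minor_share (n + n0) \<in> borel_measurable M" "(\<lambda>\<omega>. contents (n + n0) \<omega>) \<in> borel_measurable M"
      using minor_share_adapted contents_F_measurable by (auto intro: measurable_F_M)
    show "q n \<in> borel_measurable M" unfolding q_def by measurable
  qed (use q_bounds in \<open>auto intro!: AE_I2\<close>)
  define p where "p n = expectation (potential 1 (n + n0))" for n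
  have p0: "p n \<ge> 0" for n unfolding p_def using potential_nonneg[OF 1(2)] by (intro integral_nonneg_AE AE_I2) auto
  have p_step: "\<delta> * expectation (q n) \<le> p n - p (Suc n)" for n
  proof -
    have "expectation (\<lambda>\<omega>. 1 * (potential 1 (Suc (n + n0)) \<omega> - potential 1 (n + n0) \<omega>))
        \<le> - \<delta> * expectation (\<lambda>\<omega>. 1 * (minor_share (n + n0) \<omega> / contents (n + n0) \<omega>))"
      by (rule potential_drift[OF 1(1)]) (use \<delta> in auto)
    then show ?thesis
      unfolding p_def q_def using potential_int[OF 1(2)] by simp
  qed
  have "(\<Sum>i<n. expectation (q i)) \<le> p 0 / \<delta>" for n
  proof -
    have "\<delta> * (\<Sum>i<n. expectation (q i)) \<le> (\<Sum>i<n. p i - p (Suc i))"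
      unfolding sum_distrib_left by (intro sum_mono p_step)
    also have "\<dots> = p 0 - p n" by (rule sum_lessThan_telescope')
    also have "\<dots> \<le> p 0" using p0 by simp
    finally show ?thesis using \<delta>(1) by (simp add: field_simps)
  qed
  then have "AE \<omega> in M. summable (\<lambda>n. q n \<omega>)"
    by (intro AE_summable_if_sum_expectation_bounded q_int q_bounds)
  then show ?thesis unfolding q_def by (subst (asm) summable_iff_shift)
qed

section \<open>Growth of the urn\<close>

text \<open>The number of balls added at stage \<open>n + 1\<close>.\<close>
definition growth :: "nat \<Rightarrow> 'a \<Rightarrow> real" where
  "growth n \<omega> = (\<Sum>k=1..d. real (A (Suc n) k \<omega>) * real (X (Suc n) k \<omega>))"

text \<open>The conditional expectation of \<open>growth n\<close> given \<open>F n\<close>, in explicit form.\<close>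
definition expected_growth :: "nat \<Rightarrow> 'a \<Rightarrow> real" where
  "expected_growth n \<omega> = real_cond_exp M (F n) (\<lambda>\<omega>. real (N (Suc n) \<omega>)) \<omega> * (\<Sum>k=1..d. mean n k * share n k \<omega>)"

lemma growth_nonneg: "0 \<le> growth n \<omega>"
  unfolding growth_def by (intro sum_nonneg) simp

lemma growth_adapted: "growth n \<in> borel_measurable (F (Suc n))"
  unfolding growth_def
proof (rule borel_measurable_sum)
  fix k assume "k \<in> {1..d}"
  then have [measurable]: "X (Suc n) k \<in> measurable (F (Suc n)) (count_space UNIV)"
    "A (Suc n) k \<in> measurable (F (Suc n)) (count_space UNIV)"
    using F_measurable[of "Suc n" "Suc n" k] by auto
  show "(\<lambda>\<omega>. real (A (Suc n) k \<omega>) * real (X (Suc n) k \<omega>)) \<in> borel_measurable (F (Suc n))" by measurable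
qed

lemma contents_eq_sum_growth: "contents n \<omega> = contents 0 \<omega> + (\<Sum>i<n. growth i \<omega>)"
  by (induction n) (simp_all add: contents_Suc growth_def)

lemma growth_square:
  shows "integrable M (\<lambda>\<omega>. (growth n \<omega>)\<^sup>2)"
    and "expectation (\<lambda>\<omega>. (growth n \<omega>)\<^sup>2) \<le> real d * ((real C1)\<^sup>2 * (real d * B))"
proof -
  define b where "b \<omega> = real d * ((real C1)\<^sup>2 * (\<Sum>k=1..d. (real (A (Suc n) k \<omega>))\<^sup>2))" for \<omega>
  have b_int: "integrable M b" unfolding b_def
    by (intro integrable_mult_right Bochner_Integration.integrable_sum A_sq_int)
  have le: "(growth n \<omega>)\<^sup>2 \<le> b \<omega>" if w: "\<omega> \<in> space M" for \<omega>
  proof -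
    have "(growth n \<omega>)\<^sup>2 \<le> (\<Sum>k=1..d. (real (A (Suc n) k \<omega>) * real (X (Suc n) k \<omega>))\<^sup>2) * real (card {1..d})"
      unfolding growth_def by (rule sum_squared_le_sum_of_squares)
    also have "\<dots> \<le> (\<Sum>k=1..d. (real C1)\<^sup>2 * (real (A (Suc n) k \<omega>))\<^sup>2) * real (card {1..d})"
    proof (intro mult_right_mono sum_mono)
      fix k assume k: "k \<in> {1..d}"
      have "(real (X (Suc n) k \<omega>))\<^sup>2 \<le> (real C1)\<^sup>2" using draw_le(2)[OF w k, of n] by (intro power_mono) auto
      then show "(real (A (Suc n) k \<omega>) * real (X (Suc n) k \<omega>))\<^sup>2 \<le> (real C1)\<^sup>2 * (real (A (Suc n) k \<omega>))\<^sup>2"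
        unfolding power_mult_distrib by (subst mult.commute) (rule mult_right_mono, auto)
    qed simp
    also have "\<dots> = b \<omega>" unfolding b_def by (simp add: sum_distrib_left mult_ac)
    finally show ?thesis .
  qed
  have [measurable]: "growth n \<in> borel_measurable M" by (rule measurable_F_M[OF growth_adapted])
  show int: "integrable M (\<lambda>\<omega>. (growth n \<omega>)\<^sup>2)"
    by (rule Bochner_Integration.integrable_bound[OF b_int])
      (use le in \<open>auto intro!: AE_I2 intro: order.trans[OF _ abs_ge_self]\<close>)
  have "expectation (\<lambda>\<omega>. (growth n \<omega>)\<^sup>2) \<le> expectation b"
    by (intro integral_mono int b_int le)
  also have "expectation b = real d * ((real C1)\<^sup>2 * (\<Sum>k=1..d. expectation (\<lambda>\<omega>. (real (A (Suc n) k \<omega>))\<^sup>2)))"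
    unfolding b_def
    by (simp only: integral_mult_right_zero Bochner_Integration.integral_sum[OF A_sq_int])
  also have "\<dots> \<le> real d * ((real C1)\<^sup>2 * (\<Sum>k=1..d. B))"
    by (intro mult_left_mono sum_mono A_sq_le) auto
  finally show "expectation (\<lambda>\<omega>. (growth n \<omega>)\<^sup>2) \<le> real d * ((real C1)\<^sup>2 * (real d * B))" by simp
qed

lemma sum_mean_share_bounds: "0 \<le> (\<Sum>k=1..d. mean n k * share n k \<omega>)" "(\<Sum>k=1..d. mean n k * share n k \<omega>) \<le> B"
proof -
  show "0 \<le> (\<Sum>k=1..d. mean n k * share n k \<omega>)"
    by (intro sum_nonneg mult_nonneg_nonneg mean_bounds share_bounds)
  have "(\<Sum>k=1..d. mean n k * share n k \<omega>) \<le> (\<Sum>k=1..d. B * share n k \<omega>)"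
    by (intro sum_mono mult_right_mono mean_bounds share_bounds)
  also have "\<dots> = B" unfolding sum_distrib_left[symmetric] sum_share by simp
  finally show "(\<Sum>k=1..d. mean n k * share n k \<omega>) \<le> B" .
qed

lemma sum_mean_share_adapted: "(\<lambda>\<omega>. \<Sum>k=1..d. mean n k * share n k \<omega>) \<in> borel_measurable (F n)"
  by (intro borel_measurable_sum borel_measurable_times borel_measurable_const share_F_measurable)

lemma sub_F: "sigma_finite_subalgebra M (F n)"
  by (intro finite_measure_subalgebra_is_sigma_finite finite_measure_subalgebra.intro
      finite_measure_subalgebra_axioms.intro subalgebras finite_measure_axioms)

lemma N_int: "integrable M (\<lambda>\<omega>. real (N (Suc n) \<omega>))"
  by (rule integrable_const_bound[where B = C1])
    (use draw_count_bounds N_measurable[of "Suc n"] in \<open>auto intro!: AE_I2\<close>)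

lemma expected_growth_bounds: "AE \<omega> in M. 0 \<le> expected_growth n \<omega> \<and> expected_growth n \<omega> \<le> C1 * B"
proof -
  interpret sub: sigma_finite_subalgebra M "F n" by (rule sub_F)
  have "AE \<omega> in M. real_cond_exp M (F n) (\<lambda>\<omega>. real (N (Suc n) \<omega>)) \<omega> \<le> C1"
    by (rule sub.real_cond_exp_le_c[OF N_int]) (use draw_count_bounds in auto)
  moreover have "AE \<omega> in M. real_cond_exp M (F n) (\<lambda>\<omega>. real (N (Suc n) \<omega>)) \<omega> \<ge> 0"
    by (rule sub.real_cond_exp_ge_c[OF N_int]) auto
  ultimately show ?thesis
    by eventually_elim
      (use sum_mean_share_bounds in \<open>auto simp: expected_growth_def intro!: mult_mono mult_nonneg_nonneg\<close>)
qed

lemma expected_growth_adapted: "expected_growth n \<in> borel_measurable (F n)"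
  unfolding expected_growth_def using sum_mean_share_adapted by measurable

lemma cond_exp_growth: "AE \<omega> in M. real_cond_exp M (F n) (growth n) \<omega> = expected_growth n \<omega>"
proof -
  interpret sub: sigma_finite_subalgebra M "F n" by (rule sub_F)
  have EM [measurable]: "expected_growth n \<in> borel_measurable M" by (rule measurable_F_M[OF expected_growth_adapted])
  have eg_int: "integrable M (expected_growth n)"
    by (rule integrable_const_bound[where B = "C1 * B"]) (use expected_growth_bounds[of n] in auto)
  have g_int: "integrable M (growth n)"
    unfolding growth_def by (intro Bochner_Integration.integrable_sum AX_int)
  show ?thesis
  proof (rule sub.real_cond_exp_charact[OF _ g_int eg_int expected_growth_adapted])
    fix D assume D: "D \<in> sets (F n)"
    have DM: "D \<in> events" using D subalg unfolding subalgebra_def by auto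
    define w where "w \<omega> = (indicator D \<omega> :: real)" for \<omega>
    have w_F: "w \<in> borel_measurable (F n)" unfolding w_def using D by simp
    have w_M [measurable]: "w \<in> borel_measurable M" by (rule measurable_F_M[OF w_F])
    have w01: "0 \<le> w \<omega>" "w \<omega> \<le> 1" for \<omega> unfolding w_def by auto
    have w_int: "integrable M w" by (rule integrable_const_bound[where B = 1]) (use w01 in auto)
    note reinf = expectation_reinforcement[OF _ measurable_F_G[OF w_F] w_int A_int]
    define \<sigma> where "\<sigma> \<omega> = (\<Sum>k=1..d. mean n k * share n k \<omega>)" for \<omega>
    have ws_F: "(\<lambda>\<omega>. w \<omega> * \<sigma> \<omega>) \<in> borel_measurable (F n)"
      unfolding \<sigma>_def using w_F sum_mean_share_adapted by measurable
    have [measurable]: "\<sigma> \<in> borel_measurable M"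
      unfolding \<sigma>_def by (rule measurable_F_M[OF sum_mean_share_adapted])
    have [measurable]: "N (Suc n) \<in> measurable M (count_space UNIV)" using N_measurable by simp
    have wN_int: "integrable M (\<lambda>\<omega>. w \<omega> * (real (N (Suc n) \<omega>) * share n k \<omega>))" if k: "k \<in> {1..d}" for k
    proof (rule Bochner_Integration.integrable_bound[OF N_int[of n]])
      have [measurable]: "(\<lambda>\<omega>. share n k \<omega>) \<in> borel_measurable M" by (rule measurable_F_M[OF share_F_measurable[OF k]])
      show "(\<lambda>\<omega>. w \<omega> * (real (N (Suc n) \<omega>) * share n k \<omega>)) \<in> borel_measurable M" by measurable
      show "AE \<omega> in M. norm (w \<omega> * (real (N (Suc n) \<omega>) * share n k \<omega>)) \<le> norm (real (N (Suc n) \<omega>))"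
      proof (intro AE_I2)
        fix \<omega>
        have "w \<omega> * (real (N (Suc n) \<omega>) * share n k \<omega>) \<le> 1 * (real (N (Suc n) \<omega>) * 1)"
          using w01 share_bounds[OF k] by (intro mult_mono) auto
        then show "norm (w \<omega> * (real (N (Suc n) \<omega>) * share n k \<omega>)) \<le> norm (real (N (Suc n) \<omega>))"
          using w01[of \<omega>] share_bounds[OF k, of n \<omega>] by simp
      qed
    qed
    have wsN: "(w \<omega> * \<sigma> \<omega>) * real (N (Suc n) \<omega>) = (\<Sum>k=1..d. mean n k * (w \<omega> * (real (N (Suc n) \<omega>) * share n k \<omega>)))" for \<omega>
      unfolding \<sigma>_def sum_distrib_left sum_distrib_right by (intro sum.cong) auto
    have wsN_int: "integrable M (\<lambda>\<omega>. (w \<omega> * \<sigma> \<omega>) * real (N (Suc n) \<omega>))"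
      unfolding wsN by (intro Bochner_Integration.integrable_sum integrable_mult_right wN_int)
    have "expectation (\<lambda>\<omega>. w \<omega> * growth n \<omega>)
        = (\<Sum>k=1..d. expectation (\<lambda>\<omega>. w \<omega> * (real (A (Suc n) k \<omega>) * real (X (Suc n) k \<omega>))))"
      unfolding growth_def sum_distrib_left by (intro Bochner_Integration.integral_sum reinf(1))
    also have "\<dots> = (\<Sum>k=1..d. mean n k * expectation (\<lambda>\<omega>. w \<omega> * (real (N (Suc n) \<omega>) * share n k \<omega>)))"
      by (intro sum.cong refl reinf(2))
    also have "\<dots> = expectation (\<lambda>\<omega>. (w \<omega> * \<sigma> \<omega>) * real (N (Suc n) \<omega>))"
      unfolding wsN
      by (subst Bochner_Integration.integral_sum) (auto intro!: integrable_mult_right wN_int)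
    also have "\<dots> = expectation (\<lambda>\<omega>. (w \<omega> * \<sigma> \<omega>) * real_cond_exp M (F n) (\<lambda>\<omega>. real (N (Suc n) \<omega>)) \<omega>)"
      by (rule sub.real_cond_exp_intg(2)[OF wsN_int ws_F, symmetric]) measurable
    also have "\<dots> = expectation (\<lambda>\<omega>. w \<omega> * expected_growth n \<omega>)"
      unfolding expected_growth_def \<sigma>_def by (simp add: mult_ac)
    finally show "(\<integral>\<omega>\<in>D. growth n \<omega> \<partial>M) = (\<integral>\<omega>\<in>D. expected_growth n \<omega> \<partial>M)"
      unfolding set_lebesgue_integral_def w_def by simp
  qed
qed

section \<open>Linear growth rates\<close>

theorem urn_AE_limits:
  assumes N_limit: "AE \<omega> in M.
      (\<lambda>n. real_cond_exp M (F n) (\<lambda>\<omega>. real (N (Suc n) \<omega>)) \<omega>) \<longlonglongrightarrow> Nlim \<omega>"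
  shows "AE \<omega> in M.
      (\<forall>k\<in>{1..d}. convergent (\<lambda>n. share n k \<omega>)) \<and>
      (\<forall>k\<in>{1..t}. (\<lambda>n. balls n k \<omega> / real n) \<longlonglongrightarrow> Nlim \<omega> * m 1 * lim (\<lambda>n. share n k \<omega>)) \<and>
      (\<forall>k\<in>{t+1..d}. (\<lambda>n. balls n k \<omega> / real n) \<longlonglongrightarrow> 0) \<and>
      (\<lambda>n. contents n \<omega> / real n) \<longlonglongrightarrow> Nlim \<omega> * m 1"
proof -
  have lln: "AE \<omega> in M. (\<lambda>n. (\<Sum>i<n. growth i \<omega> - expected_growth i \<omega>) / real n) \<longlonglongrightarrow> 0"
    by (rule average_minus_cond_exp_AE_tendsto_0)
      (rule growth_adapted growth_nonneg growth_square expected_growth_adapted cond_exp_growth expected_growth_bounds)+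
  have conv: "AE \<omega> in M. \<forall>k\<in>{1..t}. convergent (\<lambda>n. share n k \<omega>)"
    by (intro AE_finite_allI share_AE_convergent) auto
  have bounds: "AE \<omega> in M. \<forall>n. 0 \<le> expected_growth n \<omega> \<and> expected_growth n \<omega> \<le> C1 * B"
    unfolding AE_all_countable using expected_growth_bounds by blast
  from lln conv bounds minor_share_quotient_AE_summable N_limit show ?thesis
  proof eventually_elim
    fix \<omega>
    assume lln: "(\<lambda>n. (\<Sum>i<n. growth i \<omega> - expected_growth i \<omega>) / real n) \<longlonglongrightarrow> 0"
      and conv: "\<forall>k\<in>{1..t}. convergent (\<lambda>n. share n k \<omega>)"
      and bounds: "\<forall>n. 0 \<le> expected_growth n \<omega> \<and> expected_growth n \<omega> \<le> C1 * B"
      and summ: "summable (\<lambda>n. minor_share n \<omega> / contents n \<omega>)"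
      and N_lim: "(\<lambda>n. real_cond_exp M (F n) (\<lambda>\<omega>. real (N (Suc n) \<omega>)) \<omega>) \<longlonglongrightarrow> Nlim \<omega>"
    define z where "z k = (if k \<in> {1..t} then lim (\<lambda>n. share n k \<omega>) else 0)" for k
    have major: "(\<lambda>n. share n k \<omega>) \<longlonglongrightarrow> z k" if "k \<in> {1..t}" for k
    proof -
      have "convergent (\<lambda>n. share n k \<omega>)" using conv that by blast
      then show ?thesis using that unfolding convergent_LIMSEQ_iff z_def by simp
    qed
    have split: "minor_share n \<omega> = 1 - (\<Sum>k=1..t. share n k \<omega>)" for n
    proof -
      have "{1..d} = {1..t} \<union> {t+1..d}" using t by auto
      then have "(\<Sum>k=1..d. share n k \<omega>) = (\<Sum>k=1..t. share n k \<omega>) + minor_share n \<omega>"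
        unfolding minor_share_def by (simp only:) (subst sum.union_disjoint, auto)
      then show ?thesis unfolding sum_share by simp
    qed
    have minor_lim: "(\<lambda>n. minor_share n \<omega>) \<longlonglongrightarrow> 1 - (\<Sum>k=1..t. z k)"
      unfolding split by (intro tendsto_diff tendsto_const tendsto_sum major)
    obtain W where W: "\<And>n. \<bar>(\<Sum>i<n. growth i \<omega> - expected_growth i \<omega>) / real n\<bar> \<le> W"
      using convergent_imp_Bseq[OF convergentI[OF lln]] unfolding Bseq_def by auto
    \<comment> \<open>The law of large numbers bounds the growth of the urn before its rate is known.\<close>
    have linear: "contents (Suc n) \<omega> \<le> (contents 0 \<omega> + W + C1 * B) * real (Suc n)" for n
    proof -
      have "(\<Sum>i<Suc n. growth i \<omega> - expected_growth i \<omega>) \<le> W * real (Suc n)"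
        using W[of "Suc n"] by (simp add: abs_le_iff field_simps)
      moreover have "(\<Sum>i<Suc n. expected_growth i \<omega>) \<le> C1 * B * real (Suc n)"
      proof -
        have "(\<Sum>i<Suc n. expected_growth i \<omega>) \<le> of_nat (card {..<Suc n}) * (C1 * B)"
          by (rule sum_bounded_above) (use bounds in blast)
        then show ?thesis by (simp only: card_lessThan mult.commute)
      qed
      moreover have "(contents 0 \<omega> + W + C1 * B) * real (Suc n)
          = contents 0 \<omega> + real n * contents 0 \<omega> + W * real (Suc n) + C1 * B * real (Suc n)"
        by (simp add: algebra_simps)
      moreover have "0 \<le> real n * contents 0 \<omega>" by simp
      ultimately show ?thesis
        unfolding contents_eq_sum_growth[of "Suc n"] sum_subtractf by linarith
    qed
    have "1 - (\<Sum>k=1..t. z k) = 0"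
      by (rule limit_zero_if_summable_quotient[OF minor_lim minor_share_bounds(1) _ linear summ])
        (use contents_ge_1 order.strict_trans2[OF zero_less_one] in blast)
    then have sum_z: "(\<Sum>k=1..t. z k) = 1" and minor_0: "(\<lambda>n. minor_share n \<omega>) \<longlonglongrightarrow> 0"
      using minor_lim by auto
    have minor: "(\<lambda>n. share n k \<omega>) \<longlonglongrightarrow> z k" if k: "k \<in> {t+1..d}" for k
    proof -
      have kd: "k \<in> {1..d}" using k by auto
      have "share n k \<omega> \<le> minor_share n \<omega>" for n
        unfolding minor_share_def using k t by (intro member_le_sum share_bounds) auto
      then have "(\<lambda>n. share n k \<omega>) \<longlonglongrightarrow> 0"
        by (intro tendsto_sandwich[OF _ _ tendsto_const minor_0]) (auto intro: share_bounds[OF kd] always_eventually)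
      then show ?thesis using k unfolding z_def by auto
    qed
    have share_lim: "(\<lambda>n. share n k \<omega>) \<longlonglongrightarrow> z k" if "k \<in> {1..d}" for k
      using major minor that by (cases "k \<le> t") auto
    have "(\<lambda>n. \<Sum>k=1..d. mean n k * share n k \<omega>) \<longlonglongrightarrow> (\<Sum>k=1..d. m k * z k)"
      by (intro tendsto_sum tendsto_mult mean_tendsto share_lim)
    also have "(\<Sum>k=1..d. m k * z k) = (\<Sum>k=1..t. m k * z k)"
      using t by (intro sum.mono_neutral_right) (auto simp: z_def)
    also have "\<dots> = (\<Sum>k=1..t. m 1 * z k)"
    proof (intro sum.cong refl)
      fix k assume k: "k \<in> {1..t}"
      have "(\<lambda>n. mean n k) \<longlonglongrightarrow> m 1"
        unfolding mean_equal[OF k] using t by (intro mean_tendsto) auto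
      moreover have "(\<lambda>n. mean n k) \<longlonglongrightarrow> m k" using k t by (intro mean_tendsto) auto
      ultimately have "m k = m 1" by (rule LIMSEQ_unique[rotated])
      then show "m k * z k = m 1 * z k" by simp
    qed
    also have "\<dots> = m 1" unfolding sum_distrib_left[symmetric] sum_z by simp
    finally have "(\<lambda>n. expected_growth n \<omega>) \<longlonglongrightarrow> Nlim \<omega> * m 1"
      unfolding expected_growth_def by (rule tendsto_mult[OF N_lim])
    then have average: "(\<lambda>n. (\<Sum>i<n. expected_growth i \<omega>) / real n) \<longlonglongrightarrow> Nlim \<omega> * m 1"
      by (rule cesaro_tendsto)
    have initial: "(\<lambda>n. contents 0 \<omega> * (1 / real n)) \<longlonglongrightarrow> contents 0 \<omega> * 0"
      by (intro tendsto_mult tendsto_const lim_1_over_n)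
    have "contents n \<omega> / real n = contents 0 \<omega> * (1 / real n)
        + (\<Sum>i<n. growth i \<omega> - expected_growth i \<omega>) / real n + (\<Sum>i<n. expected_growth i \<omega>) / real n" for n
      by (subst contents_eq_sum_growth) (simp add: sum_subtractf add_divide_distrib diff_divide_distrib)
    then have contents_lim: "(\<lambda>n. contents n \<omega> / real n) \<longlonglongrightarrow> Nlim \<omega> * m 1"
      using tendsto_add[OF tendsto_add[OF initial lln] average] by simp
    have balls_lim: "(\<lambda>n. balls n k \<omega> / real n) \<longlonglongrightarrow> Nlim \<omega> * m 1 * z k" if k: "k \<in> {1..d}" for k
    proof -
      have eq: "balls n k \<omega> / real n = contents n \<omega> / real n * share n k \<omega>" for n
        unfolding urn_Z_def using contents_ge_1[of n \<omega>] by simp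
      show ?thesis unfolding eq by (rule tendsto_mult[OF contents_lim share_lim[OF k]])
    qed
    have "\<forall>k\<in>{1..d}. convergent (\<lambda>n. share n k \<omega>)" using share_lim convergentI by blast
    moreover have "\<forall>k\<in>{1..t}. (\<lambda>n. balls n k \<omega> / real n) \<longlonglongrightarrow> Nlim \<omega> * m 1 * lim (\<lambda>n. share n k \<omega>)"
      using balls_lim t unfolding z_def by fastforce
    moreover have "\<forall>k\<in>{t+1..d}. (\<lambda>n. balls n k \<omega> / real n) \<longlonglongrightarrow> 0"
    proof
      fix k assume k: "k \<in> {t+1..d}"
      then have "z k = 0" unfolding z_def by auto
      then show "(\<lambda>n. balls n k \<omega> / real n) \<longlonglongrightarrow> 0" using balls_lim[of k] k by auto
    qed
    ultimately show "(\<forall>k\<in>{1..d}. convergent (\<lambda>n. share n k \<omega>)) \<and>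
      (\<forall>k\<in>{1..t}. (\<lambda>n. balls n k \<omega> / real n) \<longlonglongrightarrow> Nlim \<omega> * m 1 * lim (\<lambda>n. share n k \<omega>)) \<and>
      (\<forall>k\<in>{t+1..d}. (\<lambda>n. balls n k \<omega> / real n) \<longlonglongrightarrow> 0) \<and>
      (\<lambda>n. contents n \<omega> / real n) \<longlonglongrightarrow> Nlim \<omega> * m 1"
      using contents_lim by blast
  qed
qed

end

theorem corollary3p4:
  fixes M :: "'a measure"
    and d C1 t :: nat
    and C2 :: real
    and H0 :: "nat \<Rightarrow> nat"
    and N :: "nat \<Rightarrow> 'a \<Rightarrow> nat"
    and X A :: "nat \<Rightarrow> nat \<Rightarrow> 'a \<Rightarrow> nat"
    and m :: "nat \<Rightarrow> real"
    and Nlim :: "'a \<Rightarrow> real"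
  assumes urn: "randomly_reinforced_urn M d C1 H0 N X A"
    and A1: "\<And>k. k \<in> {1..d} \<Longrightarrow>
      (SUP n\<in>{1..}. \<integral>\<^sup>+ \<omega>. ennreal (real (A n k \<omega>) ^ 3) \<partial>M) < ennreal C2"
    and A2_limit: "\<And>k. k \<in> {1..d} \<Longrightarrow>
      (\<lambda>n. prob_space.expectation M (\<lambda>\<omega>. real (A n k \<omega>))) \<longlonglongrightarrow> m k"
    and A2_t: "t \<in> {1..d}"
    and A2_equal: "\<And>k. k \<in> {1..t} \<Longrightarrow> m k = m 1"
    and A2_gap: "t < d \<Longrightarrow> m t > m (t + 1)"
    and A2_decreasing: "\<And>k. k \<in> {t + 1..<d} \<Longrightarrow> m k \<ge> m (k + 1)"
    and A2_means: "\<And>n k. n \<ge> 1 \<Longrightarrow> k \<in> {1..t} \<Longrightarrow>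
      prob_space.expectation M (\<lambda>\<omega>. real (A n k \<omega>)) = prob_space.expectation M (\<lambda>\<omega>. real (A n 1 \<omega>))"
    and Nlim_measurable: "Nlim \<in> borel_measurable M"
    and N_limit: "AE \<omega> in M.
      (\<lambda>n. real_cond_exp M (urn_F M d N X A n) (\<lambda>\<omega>. real (N (Suc n) \<omega>)) \<omega>) \<longlonglongrightarrow> Nlim \<omega>"
  shows "AE \<omega> in M.
      (\<forall>k\<in>{1..d}. convergent (\<lambda>n. urn_Z d H0 X A n k \<omega>)) \<and>
      (\<forall>k\<in>{1..t}. (\<lambda>n. real (urn_H H0 X A n k \<omega>) / real n)
          \<longlonglongrightarrow> Nlim \<omega> * m 1 * lim (\<lambda>n. urn_Z d H0 X A n k \<omega>)) \<and>
      (\<forall>k\<in>{t + 1..d}. (\<lambda>n. real (urn_H H0 X A n k \<omega>) / real n) \<longlonglongrightarrow> 0) \<and>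
      (\<lambda>n. real (urn_S d H0 X A n \<omega>) / real n) \<longlonglongrightarrow> Nlim \<omega> * m 1"
proof -
  interpret urn: randomly_reinforced_urn M d C1 H0 N X A by (rule urn)
  have cube: "(\<integral>\<^sup>+ \<omega>. ennreal (real (A (Suc n) k \<omega>) ^ 3) \<partial>M) < ennreal C2" if "k \<in> {1..d}" for n k
    by (rule le_less_trans[OF SUP_upper A1[OF that]]) simp
  \<comment> \<open>Replacements are at least \<open>1\<close>, so third moments dominate second moments.\<close>
  have sq: "(\<integral>\<^sup>+ \<omega>. ennreal ((real (A (Suc n) k \<omega>))\<^sup>2) \<partial>M) < ennreal C2" if k: "k \<in> {1..d}" for n k
  proof (rule le_less_trans[OF nn_integral_mono cube[OF k]])
    fix \<omega> assume "\<omega> \<in> space M"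
    then have "1 \<le> real (A (Suc n) k \<omega>)" using urn.A_ge_1[OF k, of \<omega> n] by simp
    then show "ennreal ((real (A (Suc n) k \<omega>))\<^sup>2) \<le> ennreal (real (A (Suc n) k \<omega>) ^ 3)"
      by (intro ennreal_leI power_increasing) auto
  qed
  have sq_int: "integrable M (\<lambda>\<omega>. (real (A (Suc n) k \<omega>))\<^sup>2)" if k: "k \<in> {1..d}" for n k
    by (rule integrableI_nonneg)
      (use urn.A_measurable[of "Suc n" k] k sq[OF k, of n] in \<open>auto intro: less_trans\<close>)
  interpret dominated_urn M d C1 H0 N X A t m "max 0 C2"
  proof
    fix n k assume k: "k \<in> {1..d}"
    show "integrable M (\<lambda>\<omega>. (real (A (Suc n) k \<omega>))\<^sup>2)" by (rule sq_int[OF k])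
    have "ennreal (urn.expectation (\<lambda>\<omega>. (real (A (Suc n) k \<omega>))\<^sup>2)) < ennreal C2"
      using sq[OF k, of n] nn_integral_eq_integral[OF sq_int[OF k, of n]] by simp
    then show "urn.expectation (\<lambda>\<omega>. (real (A (Suc n) k \<omega>))\<^sup>2) \<le> max 0 C2"
      by (simp add: ennreal_less_iff integral_nonneg_AE)
  next
    fix k assume "k \<in> {1..d}"
    then show "(\<lambda>n. urn.expectation (\<lambda>\<omega>. real (A (Suc n) k \<omega>))) \<longlonglongrightarrow> m k"
      using A2_limit by (subst filterlim_sequentially_Suc)
  next
    fix n k assume "k \<in> {1..t}"
    then show "urn.expectation (\<lambda>\<omega>. real (A (Suc n) k \<omega>)) = urn.expectation (\<lambda>\<omega>. real (A (Suc n) 1 \<omega>))"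
      by (intro A2_means) auto
  next
    fix k assume k: "k \<in> {t + 1..d}"
    have "m k \<le> m (t + 1)" if "t + 1 \<le> k" "k \<le> d" for k
      using that
    proof (induction k rule: dec_induct)
      case (step k)
      then show ?case using A2_decreasing[of k] by auto
    qed simp
    then have "m k \<le> m (t + 1)" using k by auto
    also have "\<dots> < m t" using A2_gap k by auto
    also have "m t = m 1" using A2_equal[of t] A2_t by auto
    finally show "m k < m 1" .
  qed (rule A2_t)
  show ?thesis by (rule urn_AE_limits[OF N_limit])
qed

end
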